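(* Let $F:\mathbb{R}^{m\times n}\to\mathbb{R}^{m\times n}$ (not necessarily a gradient field) be of class $C^4$ in a neighborhood of a simple zero $X^\ast$, with $A^\ast:=DF(X^\ast)$ invertible, $B^\ast:=D^2F(X^\ast)$, $C^\ast:=D^3F(X^\ast)$. Define the Halley iteration map $$\mathcal H(X):=X+\Big(I+\tfrac12 L(X)\Big)^{-1}H(X),\qquad H(X):=-A(X)^{-1}F(X),\qquad L(X)[\cdot]:=A(X)^{-1}D^2F(X)[H(X),\cdot],$$ where $A(X):=DF(X)$, wherever $I+\tfrac12 L(X)$ is invertible. Then: (1) There exists a neighborhood $\mathcal U$ of $X^\ast$ on which $\mathcal H$ is well defined and of class $C^3$, and for every direction $U\in\mathbb{R}^{m\times n}$, $$D\mathcal H(X^\ast)[U]=0,\qquad D^2\mathcal H(X^\ast)[U,U]=0,\qquad D^3\mathcal H(X^\ast)[U,U,U]=-\tfrac12\,\widetilde{\mathcal S}F(X^\ast)[U,U,U],$$ where $$\widetilde{\mathcal S}F(X^\ast)[U,U,U]:=2A^{\ast-1}C^\ast[U,U,U]-3A^{\ast-1}B^\ast\big[U,A^{\ast-1}B^\ast[U,U]\big].$$ (2) There exist constants $r>0$ and $C>0$ such that, whenever $\|X_0-X^\ast\|_F<r$, the Halley iteration $X_{k+1}=\mathcal H(X_k)$ is well defined for all $k$, remains in $\mathcal U$, converges to $X^\ast$, and satisfies $$\|X_{k+1}-X^\ast\|_F\le C\,\|X_k-X^\ast\|_F^3 .$$ (3) Consequently, for any sequence $X_k\to X^\ast$ generated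 by the Halley iteration, $$X_{k+1}-X^\ast=-\frac1{12}\,\widetilde{\mathcal S}F(X^\ast)\big[X_k-X^\ast,X_k-X^\ast,X_k-X^\ast\big]+o\big(\|X_k-X^\ast\|_F^3\big),$$ so that the local order of convergence is at least $3$ in every case, and is exactly $3$ along any asymptotic direction $U$ for which $\widetilde{\mathcal S}F(X^\ast)[U,U,U]\neq0$.
   Context: $\mathbb{R}^{m\times n}$ is a real Hilbert space with the Frobenius inner product $\langle U,V\rangle=\mathrm{tr}(U^\top V)$ and norm $\|\cdot\|_F$. $DF(X)$, $D^2F(X)$, $D^3F(X)$ are the Fréchet derivatives of $F$: respectively a linear operator, a symmetric bilinear map and a symmetric trilinear map on $\mathbb{R}^{m\times n}$ with values in $\mathbb{R}^{m\times n}$. $I$ is the identity operator on $\mathbb{R}^{m\times n}$, and $A^{\ast-1}=(A^\ast)^{-1}$. A simple zero is a point $X^\ast$ with $F(X^\ast)=0$ and $DF(X^\ast)$ invertible. The quantity $\widetilde{\mathcal S}F(X^\ast)$ is called the matrix Schwarzian derivative of $F$ at $X^\ast$. With $e_k:=X_k-X^\ast$, an asymptotic direction of the sequence is a unit vector $U$ with $e_k/\|e_k\|_F\to U$ (all $e_k\ne0$); order at least $3$ means $\|e_{k+1}\|_F=O(\|e_k\|_F^3)$, and exactly $3$ means that $\|e_{k+1}\|_F/\|e_k\|_F^3$ tends to a finite nonzero limit.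
   Formalization: For F of class C^4 the Halley map need not be C^3 near X*, as it contains D^2F; proved instead: it is C^2 on the neighborhood, its second derivative is differentiable at X*, and it is C^3 there if F is C^5. All other claims are proved under C^4. *)

theory Defs
  imports "HOL-Analysis.Analysis" "HOL-Library.Landau_Symbols"
begin

section \<open>The Frobenius structure\<close>

text \<open>
  A matrix in $\mathbb{R}^{m \times n}$ is an element of type \<open>real^'n^'m\<close> ('m rows, 'n columns).
  The library inner product on this type, and hence its norm, is the Frobenius one.
\<close>

lemma inner_matrix_eq_trace:
  fixes U V :: "real^'n^'m"
  shows "U \<bullet> V = trace (transpose U ** V)"
proof -
  have "U \<bullet> V = (\<Sum>i\<in>UNIV. \<Sum>j\<in>UNIV. U $ i $ j * V $ i $ j)"
    by (simp add: inner_vec_def)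
  also have "\<dots> = (\<Sum>j\<in>UNIV. \<Sum>i\<in>UNIV. U $ i $ j * V $ i $ j)"
    by (rule sum.swap)
  also have "\<dots> = trace (transpose U ** V)"
    by (simp add: trace_def transpose_def matrix_matrix_mult_def)
  finally show ?thesis .
qed

section \<open>Higher Frechet derivatives and the classes $C^k$\<close>

text \<open>
  \<open>frechet f x\<close> is the derivative as an element of the Banach space of bounded operators, so that
  it can be differentiated again: \<open>frechet (frechet f) x U V\<close> is $D^2 f(x)[U,V]$. It is meaningful
  only where \<open>f\<close> is differentiable.
\<close>

definition frechet ::
  "('a::real_normed_vector \<Rightarrow> 'b::real_normed_vector) \<Rightarrow> 'a \<Rightarrow> ('a \<Rightarrow>\<^sub>L 'b)"
  where "frechet f x = Blinfun (frechet_derivative f (at x))"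

text \<open>
  A recursion on $k$ is not typable, since the codomain of the derivative changes with every step;
  hence one constant per $k$. The set is meant to be open.
\<close>

definition C1_on ::
  "'a::real_normed_vector set \<Rightarrow> ('a \<Rightarrow> 'b::real_normed_vector) \<Rightarrow> bool"
  where "C1_on S f \<longleftrightarrow> (\<forall>x\<in>S. f differentiable (at x)) \<and> continuous_on S (frechet f)"

definition C2_on ::
  "'a::real_normed_vector set \<Rightarrow> ('a \<Rightarrow> 'b::real_normed_vector) \<Rightarrow> bool"
  where "C2_on S f \<longleftrightarrow> (\<forall>x\<in>S. f differentiable (at x)) \<and> C1_on S (frechet f)"

definition C3_on ::
  "'a::real_normed_vector set \<Rightarrow> ('a \<Rightarrow> 'b::real_normed_vector) \<Rightarrow> bool"
  where "C3_on S f \<longleftrightarrow> (\<forall>x\<in>S. f differentiable (at x)) \<and> C2_on S (frechet f)"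

definition C4_on ::
  "'a::real_normed_vector set \<Rightarrow> ('a \<Rightarrow> 'b::real_normed_vector) \<Rightarrow> bool"
  where "C4_on S f \<longleftrightarrow> (\<forall>x\<in>S. f differentiable (at x)) \<and> C3_on S (frechet f)"

definition C5_on ::
  "'a::real_normed_vector set \<Rightarrow> ('a \<Rightarrow> 'b::real_normed_vector) \<Rightarrow> bool"
  where "C5_on S f \<longleftrightarrow> (\<forall>x\<in>S. f differentiable (at x)) \<and> C4_on S (frechet f)"

section \<open>The Halley iteration\<close>

text \<open>
  Inverses of operators are the function inverses \<open>inv\<close>, and invertibility is \<open>bij\<close>; on
  $\mathbb{R}^{m \times n}$ the inverse of a bijective linear map is again linear and bounded.
\<close>

definition simple_zero :: "('a::real_normed_vector \<Rightarrow> 'a) \<Rightarrow> 'a \<Rightarrow> bool"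
  where "simple_zero F X \<longleftrightarrow> F X = 0 \<and> bij (blinfun_apply (frechet F X))"

definition newton_step :: "('a::real_normed_vector \<Rightarrow> 'a) \<Rightarrow> 'a \<Rightarrow> 'a"
  where "newton_step F X = - inv (blinfun_apply (frechet F X)) (F X)"

definition halley_L :: "('a::real_normed_vector \<Rightarrow> 'a) \<Rightarrow> 'a \<Rightarrow> 'a \<Rightarrow> 'a"
  where "halley_L F X V =
    inv (blinfun_apply (frechet F X)) (frechet (frechet F) X (newton_step F X) V)"

definition halley_op :: "('a::real_normed_vector \<Rightarrow> 'a) \<Rightarrow> 'a \<Rightarrow> 'a \<Rightarrow> 'a"
  where "halley_op F X V = V + (1/2) *\<^sub>R halley_L F X V"

definition halley :: "('a::real_normed_vector \<Rightarrow> 'a) \<Rightarrow> 'a \<Rightarrow> 'a"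
  where "halley F X = X + inv (halley_op F X) (newton_step F X)"

text \<open>
  The function \<open>halley F\<close> is total in HOL; its mathematical domain consists of the points where
  \<open>F\<close> is twice differentiable and both operators that are inverted are invertible.
\<close>

definition halley_defined :: "('a::real_normed_vector \<Rightarrow> 'a) \<Rightarrow> 'a \<Rightarrow> bool"
  where "halley_defined F X \<longleftrightarrow>
    (\<forall>\<^sub>F Y in nhds X. F differentiable (at Y)) \<and> frechet F differentiable (at X) \<and>
    bij (blinfun_apply (frechet F X)) \<and> bij (halley_op F X)"

definition halley_sequence :: "('a::real_normed_vector \<Rightarrow> 'a) \<Rightarrow> (nat \<Rightarrow> 'a) \<Rightarrow> bool"
  where "halley_sequence F X \<longleftrightarrow>
    (\<forall>k. halley_defined F (X k) \<and> X (Suc k) = halley F (X k))"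

text \<open>The cubic form $\widetilde{\mathcal S}F(X)[U,U,U]$.\<close>

definition matrix_schwarzian :: "('a::real_normed_vector \<Rightarrow> 'a) \<Rightarrow> 'a \<Rightarrow> 'a \<Rightarrow> 'a"
  where "matrix_schwarzian F X U =
    (let Ainv = inv (blinfun_apply (frechet F X));
         B = (\<lambda>V W. frechet (frechet F) X V W);
         C = (\<lambda>V W Z. frechet (frechet (frechet F)) X V W Z)
     in 2 *\<^sub>R Ainv (C U U U) - 3 *\<^sub>R Ainv (B U (Ainv (B U U))))"

section \<open>Order of convergence\<close>

definition order_at_least :: "nat \<Rightarrow> (nat \<Rightarrow> 'a::real_normed_vector) \<Rightarrow> 'a \<Rightarrow> bool"
  where "order_at_least p X L \<longleftrightarrow>
    (\<lambda>k. norm (X (Suc k) - L)) \<in> O(\<lambda>k. norm (X k - L) ^ p)"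

definition order_exactly :: "nat \<Rightarrow> (nat \<Rightarrow> 'a::real_normed_vector) \<Rightarrow> 'a \<Rightarrow> bool"
  where "order_exactly p X L \<longleftrightarrow>
    (\<exists>l. l \<noteq> 0 \<and> (\<lambda>k. norm (X (Suc k) - L) / norm (X k - L) ^ p) \<longlonglongrightarrow> l)"

definition asymptotic_direction ::
  "(nat \<Rightarrow> 'a::real_normed_vector) \<Rightarrow> 'a \<Rightarrow> 'a \<Rightarrow> bool"
  where "asymptotic_direction X L U \<longleftrightarrow>
    norm U = 1 \<and> (\<forall>k. X k \<noteq> L) \<and> (\<lambda>k. (X k - L) /\<^sub>R norm (X k - L)) \<longlonglongrightarrow> U"

end

theory Submission
  imports Defs
begin

text \<open>
  Write $A = DF$, $B = D^2F$, $C = D^3F$, let $H$ be the Newton step and $z = \mathcal{H} - \mathrm{id}$ the Halley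
  step. Near the zero $X^\ast$ the two steps solve
  \[ A(x) H(x) = -F(x), \qquad P(x) z(x) = -F(x), \qquad P(x) = A(x) + \tfrac12 B(x)[H(x), \cdot]. \]
  Differentiating these equations at $X^\ast$ in a direction $U$, where $F$, $H$ and $z$ vanish, gives
  $H' = -U$ and $H'' = w := A^{-1}B[U,U]$, hence $P' = \frac12 B[U, \cdot]$ and $P'' = \frac12 B[w, \cdot]$, and then
  $z' = -U$, $z'' = 0$ and $A z''' = \frac32 B[w,U] - C[U,U,U]$ (\<open>equation_derivatives\<close>,
  \<open>z_derivatives\<close>). By the symmetry of $B$ (\<open>dir_deriv_commute\<close>) the last value is
  $-\frac12$ times the Schwarzian.

  For regularity, $A$ is one and $B$ two orders less regular than $F$, and inversion of operators
  preserves $C^k$ (\<open>Ck_on_blinfun_inv\<close>); thus $\mathcal{H}$ is $C^2$ if $F$ is $C^4$, and $C^3$ if $F$ is $C^5$.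
  For $F$ of class $C^4$ the third derivative of $\mathcal{H}$ at $X^\ast$ still exists: $z$ is
  a $C^2$ operator $(I + \frac12 L)^{-1}$ applied to the $C^3$ map $H$, and in $D^2 z$ the second derivative of the
  operator is applied to $H$, which vanishes at $X^\ast$
  (\<open>has_derivative_dir_deriv2_bilinear_vanishing\<close>).

  Taylor's formula with Peano remainder (\<open>taylor_young_3\<close>) turns these derivatives into
  $\mathcal{H}(X^\ast + e) - X^\ast = -\frac1{12} \widetilde{\mathcal{S}}F(X^\ast)[e,e,e] + o(\|e\|^3)$, from which all
  assertions on convergence follow.
\<close>

section \<open>Directional derivatives and the classes $C^k$\<close>

text \<open>
  The derivative of \<open>f\<close> at \<open>x\<close> in the direction \<open>v\<close>, meaningful where \<open>f\<close> is differentiable. The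
  direction comes first, so that \<open>dir_deriv v f\<close> is again a function with the codomain of \<open>f\<close>.
\<close>

definition dir_deriv ::
  "'a::real_normed_vector \<Rightarrow> ('a \<Rightarrow> 'b::real_normed_vector) \<Rightarrow> 'a \<Rightarrow> 'b"
  where "dir_deriv v f x = frechet_derivative f (at x) v"

text \<open>
  The class $C^k$ on an open set, by recursion on $k$: a function is $C^{k+1}$ if it is differentiable
  and all its directional derivatives are $C^k$. Unlike the operator-valued derivative, a directional
  derivative does not change the codomain, which makes the recursion typable and allows induction
  on $k$. On a Euclidean domain the classes are the usual ones, as \<open>Ck_on_Suc_iff_frechet\<close> shows.
\<close>

primrec Ck_on ::
  "nat \<Rightarrow> 'a::real_normed_vector set \<Rightarrow> ('a \<Rightarrow> 'b::real_normed_vector) \<Rightarrow> bool"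
where
  "Ck_on 0 S f = continuous_on S f"
| "Ck_on (Suc k) S f = ((\<forall>x\<in>S. f differentiable (at x)) \<and> (\<forall>v. Ck_on k S (dir_deriv v f)))"

lemma dir_deriv_eq:
  assumes "(f has_derivative f') (at x)"
  shows "dir_deriv v f x = f' v"
  using frechet_derivative_at[OF assms] by (simp add: dir_deriv_def)

lemma has_derivative_dir_deriv:
  assumes "f differentiable (at x)"
  shows "(f has_derivative (\<lambda>v. dir_deriv v f x)) (at x)"
  using assms unfolding dir_deriv_def by (simp add: frechet_derivative_works)

lemma frechet_apply:
  assumes "f differentiable (at x)"
  shows "blinfun_apply (frechet f x) v = dir_deriv v f x"
  using has_derivative_bounded_linear[OF has_derivative_dir_deriv[OF assms]]
  unfolding frechet_def dir_deriv_def by (simp add: bounded_linear_Blinfun_apply)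

lemma dir_deriv_cong:
  assumes "open S" "\<And>x. x \<in> S \<Longrightarrow> f x = g x" "x \<in> S" "f differentiable (at x)"
  shows "dir_deriv v f x = dir_deriv v g x"
  unfolding dir_deriv_def
  by (rule fun_cong[OF frechet_derivative_transform_within_open[OF assms(4,1,3,2)]])

lemma differentiable_cong_open:
  assumes "open S" "\<And>x. x \<in> S \<Longrightarrow> f x = g x" "x \<in> S" "f differentiable (at x)"
  shows "g differentiable (at x)"
  using assms has_derivative_transform_within_open unfolding differentiable_def by blast

lemma Ck_on_cong:
  assumes "open S" "\<And>x. x \<in> S \<Longrightarrow> f x = g x" "Ck_on k S f"
  shows "Ck_on k S g"
  using assms(2,3)
proof (induction k arbitrary: f g)
  case 0
  then show ?case using continuous_on_cong by force
next
  case (Suc k)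
  have "g differentiable (at x)" if "x \<in> S" for x
    using differentiable_cong_open[OF assms(1), of f g] Suc.prems that by auto
  moreover have "Ck_on k S (dir_deriv v g)" for v
  proof (rule Suc.IH[of "dir_deriv v f"])
    show "dir_deriv v f x = dir_deriv v g x" if "x \<in> S" for x
      using dir_deriv_cong[OF assms(1), of f g] Suc.prems that by auto
  qed (use Suc.prems in auto)
  ultimately show ?case by simp
qed

lemma Ck_on_imp_differentiable:
  "Ck_on (Suc k) S f \<Longrightarrow> x \<in> S \<Longrightarrow> f differentiable (at x)"
  by simp

lemma Ck_on_dir_deriv: "Ck_on (Suc k) S f \<Longrightarrow> Ck_on k S (dir_deriv v f)"
  by simp

lemma Ck_on_imp_continuous_on: "Ck_on k S f \<Longrightarrow> continuous_on S f"
  by (cases k)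
    (auto simp: continuous_on_eq_continuous_within intro: continuous_at_imp_continuous_at_within
      differentiable_imp_continuous_within)

lemma Ck_on_pred: "Ck_on (Suc k) S f \<Longrightarrow> Ck_on k S f"
proof (induction k arbitrary: f)
  case 0
  then show ?case using Ck_on_imp_continuous_on[of "Suc 0" S f] by simp
next
  case (Suc k)
  have "Ck_on k S (dir_deriv v f)" for v
    by (rule Suc.IH) (rule Ck_on_dir_deriv[OF Suc.prems])
  then show ?case using Suc.prems by simp
qed

lemma Ck_on_le: "k \<le> l \<Longrightarrow> Ck_on l S f \<Longrightarrow> Ck_on k S f"
  by (induction l) (auto simp: le_Suc_eq dest: Ck_on_pred simp del: Ck_on.simps)

lemma Ck_on_subset: "Ck_on k S f \<Longrightarrow> T \<subseteq> S \<Longrightarrow> Ck_on k T f"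
  by (induction k arbitrary: f) (auto intro: continuous_on_subset)

lemma dir_deriv_const [simp]: "dir_deriv v (\<lambda>x. c) = (\<lambda>x. 0)"
  by (rule ext) (simp add: dir_deriv_def)

lemma Ck_on_const: "Ck_on k S (\<lambda>x. c)"
  by (induction k arbitrary: c) auto

lemma dir_deriv_ident [simp]: "dir_deriv v (\<lambda>x. x) = (\<lambda>x. v)"
  by (rule ext) (simp add: dir_deriv_def)

lemma Ck_on_ident: "Ck_on k S (\<lambda>x. x)"
  by (cases k) (auto simp: Ck_on_const continuous_on_id)

lemma dir_deriv_add:
  assumes "f differentiable (at x)" "g differentiable (at x)"
  shows "dir_deriv v (\<lambda>x. f x + g x) x = dir_deriv v f x + dir_deriv v g x"
  by (rule dir_deriv_eq has_derivative_add has_derivative_dir_deriv assms)+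

lemma Ck_on_add:
  assumes "open S" "Ck_on k S f" "Ck_on k S g"
  shows "Ck_on k S (\<lambda>x. f x + g x)"
  using assms(2,3)
proof (induction k arbitrary: f g)
  case 0
  then show ?case by (simp add: continuous_on_add)
next
  case (Suc k)
  have "Ck_on k S (dir_deriv v (\<lambda>x. f x + g x))" for v
  proof (rule Ck_on_cong[OF assms(1), of "\<lambda>x. dir_deriv v f x + dir_deriv v g x"])
    show "Ck_on k S (\<lambda>x. dir_deriv v f x + dir_deriv v g x)"
      by (rule Suc.IH[OF Suc.prems[THEN Ck_on_dir_deriv]])
  qed (use Suc.prems in \<open>simp add: dir_deriv_add\<close>)
  then show ?case using Suc.prems by auto
qed

lemma dir_deriv_bounded_linear:
  assumes "bounded_linear T" "f differentiable (at x)"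
  shows "dir_deriv v (\<lambda>x. T (f x)) x = T (dir_deriv v f x)"
  by (rule dir_deriv_eq bounded_linear.has_derivative[OF assms(1)]
      has_derivative_dir_deriv assms)+

lemma differentiable_bounded_linear:
  assumes "bounded_linear T" "f differentiable (at x)"
  shows "(\<lambda>x. T (f x)) differentiable (at x)"
  using bounded_linear.has_derivative[OF assms(1)] assms(2) unfolding differentiable_def by blast

lemma Ck_on_bounded_linear:
  assumes "open S" "bounded_linear T" "Ck_on k S f"
  shows "Ck_on k S (\<lambda>x. T (f x))"
  using assms(3)
proof (induction k arbitrary: f)
  case 0
  then show ?case by (simp add: bounded_linear.continuous_on[OF assms(2)])
next
  case (Suc k)
  have "Ck_on k S (dir_deriv v (\<lambda>x. T (f x)))" for v
  proof (rule Ck_on_cong[OF assms(1), of "\<lambda>x. T (dir_deriv v f x)"])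
    show "Ck_on k S (\<lambda>x. T (dir_deriv v f x))"
      by (rule Suc.IH[OF Ck_on_dir_deriv[OF Suc.prems]])
  qed (use Suc.prems assms(2) in \<open>simp add: dir_deriv_bounded_linear\<close>)
  then show ?case using Suc.prems differentiable_bounded_linear[OF assms(2)] by auto
qed

lemma Ck_on_minus: "open S \<Longrightarrow> Ck_on k S f \<Longrightarrow> Ck_on k S (\<lambda>x. - f x)"
  by (rule Ck_on_bounded_linear) (auto intro: bounded_linear_minus bounded_linear_ident)

lemma Ck_on_scaleR: "open S \<Longrightarrow> Ck_on k S f \<Longrightarrow> Ck_on k S (\<lambda>x. c *\<^sub>R f x)"
  by (rule Ck_on_bounded_linear) (auto intro: bounded_linear_scaleR_right)

lemma Ck_on_sum:
  assumes "open S" "finite I" "\<And>i. i \<in> I \<Longrightarrow> Ck_on k S (f i)"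
  shows "Ck_on k S (\<lambda>x. \<Sum>i\<in>I. f i x)"
  using assms(2,3) by induction (auto intro: Ck_on_const Ck_on_add[OF assms(1)])

lemma dir_deriv_bilinear:
  assumes "bounded_bilinear bop" "f differentiable (at x)" "g differentiable (at x)"
  shows "dir_deriv v (\<lambda>x. bop (f x) (g x)) x
    = bop (dir_deriv v f x) (g x) + bop (f x) (dir_deriv v g x)"
  using dir_deriv_eq[OF bounded_bilinear.FDERIV[OF assms(1) has_derivative_dir_deriv[OF assms(2)]
        has_derivative_dir_deriv[OF assms(3)]]]
  by (simp add: add.commute)

lemma differentiable_bilinear:
  assumes "bounded_bilinear bop" "f differentiable (at x)" "g differentiable (at x)"
  shows "(\<lambda>x. bop (f x) (g x)) differentiable (at x)"
  using bounded_bilinear.FDERIV[OF assms(1)] assms(2,3) unfolding differentiable_def by blast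

lemma Ck_on_bilinear:
  assumes "open S" "bounded_bilinear bop" "Ck_on k S f" "Ck_on k S g"
  shows "Ck_on k S (\<lambda>x. bop (f x) (g x))"
  using assms(3,4)
proof (induction k arbitrary: f g)
  case 0
  then show ?case by (simp add: bounded_bilinear.continuous_on[OF assms(2)])
next
  case (Suc k)
  have "Ck_on k S (dir_deriv v (\<lambda>x. bop (f x) (g x)))" for v
  proof (rule Ck_on_cong[OF assms(1),
        of "\<lambda>x. bop (dir_deriv v f x) (g x) + bop (f x) (dir_deriv v g x)"])
    show "Ck_on k S (\<lambda>x. bop (dir_deriv v f x) (g x) + bop (f x) (dir_deriv v g x))"
      by (rule Ck_on_add[OF assms(1)]; rule Suc.IH)
        (rule Ck_on_dir_deriv Ck_on_pred, rule Suc.prems)+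
  qed (use Suc.prems assms(2) in \<open>simp add: dir_deriv_bilinear\<close>)
  moreover have "(\<lambda>x. bop (f x) (g x)) differentiable (at x)" if "x \<in> S" for x
    by (rule differentiable_bilinear[OF assms(2)]) (use Suc.prems that in simp_all)
  ultimately show ?case by simp
qed

text \<open>
  The product rule needs only continuity of one factor where the other factor vanishes. This gives
  the derivative of operator inversion, and it saves one order of differentiability at a zero.
\<close>

lemma has_derivative_bilinear_vanishing:
  fixes f :: "'a::real_normed_vector \<Rightarrow> 'b::real_normed_vector"
    and g :: "'a \<Rightarrow> 'c::real_normed_vector" and bop :: "'b \<Rightarrow> 'c \<Rightarrow> 'd::real_normed_vector"
  assumes "bounded_bilinear bop" "isCont f x" "(g has_derivative g') (at x)" "g x = 0"
  shows "((\<lambda>y. bop (f y) (g y)) has_derivative (\<lambda>v. bop (f x) (g' v))) (at x)"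
proof -
  interpret bounded_bilinear bop by fact
  have g': "bounded_linear g'" using assms(3) by (rule has_derivative_bounded_linear)
  obtain K where K: "\<And>a b. norm (bop a b) \<le> norm a * norm b * K" and "K \<ge> 0"
    using nonneg_bounded by blast
  obtain M where M: "\<And>v. norm (g' v) \<le> norm v * M" and "M \<ge> 0"
    using bounded_linear.nonneg_bounded[OF g'] by blast
  have 1: "((\<lambda>y. bop (f y) ((g y - g x - g' (y - x)) /\<^sub>R norm (y - x))) \<longlongrightarrow> bop (f x) 0) (at x)"
    using assms(2,3) unfolding has_derivative_at_within isCont_def
    by (intro tendsto) auto
  have 2: "((\<lambda>y. bop (f y - f x) (g' (y - x) /\<^sub>R norm (y - x))) \<longlongrightarrow> 0) (at x)"
  proof (rule Lim_null_comparison)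
    show "\<forall>\<^sub>F y in at x. norm (bop (f y - f x) (g' (y - x) /\<^sub>R norm (y - x)))
      \<le> norm (f y - f x) * (M * K)"
    proof (rule eventually_at_topological[THEN iffD2], intro exI[of _ UNIV] conjI ballI impI)
      fix y assume "y \<noteq> x"
      then have "norm (g' (y - x) /\<^sub>R norm (y - x)) \<le> M"
        using M[of "y - x"] by (simp add: field_simps)
      then have "norm (f y - f x) * norm (g' (y - x) /\<^sub>R norm (y - x)) * K
        \<le> norm (f y - f x) * M * K"
        using \<open>K \<ge> 0\<close> by (intro mult_right_mono mult_left_mono) auto
      then show "norm (bop (f y - f x) (g' (y - x) /\<^sub>R norm (y - x)))
        \<le> norm (f y - f x) * (M * K)"
        using K[of "f y - f x" "g' (y - x) /\<^sub>R norm (y - x)"] by (simp add: mult.assoc)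
    qed auto
    have "((\<lambda>y. norm (f y - f x)) \<longlongrightarrow> norm (f x - f x)) (at x)"
      using assms(2) unfolding isCont_def by (intro tendsto_intros)
    from tendsto_mult_right[OF this, of "M * K"]
    show "((\<lambda>y. norm (f y - f x) * (M * K)) \<longlongrightarrow> 0) (at x)" by simp
  qed
  have "((\<lambda>y. (bop (f y) (g y) - bop (f x) (g x) - bop (f x) (g' (y - x))) /\<^sub>R norm (y - x))
    \<longlongrightarrow> 0) (at x)"
    using tendsto_add[OF 1 2] assms(4)
    by (simp add: diff_right diff_left scaleR_right zero_right flip: scaleR_add_right)
  moreover have "bounded_linear (\<lambda>v. bop (f x) (g' v))"
    using bounded_linear_compose[OF bounded_linear_right g'] .
  ultimately show ?thesis unfolding has_derivative_at_within by simp
qed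

subsection \<open>Operator-valued functions\<close>

lemma bounded_linear_rank_one:
  "bounded_linear (\<lambda>w. blinfun_scaleR_left w o\<^sub>L blinfun_inner_left i)"
  by (rule bounded_linear_compose[OF
        bounded_bilinear.bounded_linear_left[OF bounded_bilinear_blinfun_compose]
        bounded_linear_blinfun_scaleR_left])

text \<open>
  On a Euclidean space an operator depends on finitely many of its values through bounded linear
  maps; hence regularity of an operator-valued function can be tested pointwise.
\<close>

lemma blinfun_rank_one_expansion:
  fixes T :: "'c::euclidean_space \<Rightarrow>\<^sub>L 'b::real_normed_vector"
  shows "T = (\<Sum>i\<in>Basis. blinfun_scaleR_left (T i) o\<^sub>L blinfun_inner_left i)"
proof (rule blinfun_eqI)
  fix y
  have "T y = T (\<Sum>i\<in>Basis. (y \<bullet> i) *\<^sub>R i)"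
    by (simp add: euclidean_representation)
  also have "\<dots> = (\<Sum>i\<in>Basis. blinfun_scaleR_left (T i) o\<^sub>L blinfun_inner_left i) y"
    by (simp add: blinfun.sum_right blinfun.sum_left blinfun.scaleR_right
        blinfun_inner_left.rep_eq)
  finally show "T y = \<dots>" .
qed

lemma Ck_on_blinfun_iff:
  fixes g :: "'a::real_normed_vector \<Rightarrow> 'c::euclidean_space \<Rightarrow>\<^sub>L 'b::real_normed_vector"
  assumes "open S"
  shows "Ck_on k S g \<longleftrightarrow> (\<forall>v. Ck_on k S (\<lambda>x. g x v))"
proof
  assume "Ck_on k S g"
  then show "\<forall>v. Ck_on k S (\<lambda>x. g x v)"
    using Ck_on_bounded_linear[OF assms bounded_linear_apply_blinfun] by blast
next
  assume *: "\<forall>v. Ck_on k S (\<lambda>x. g x v)"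
  have "Ck_on k S (\<lambda>x. \<Sum>i\<in>Basis. blinfun_scaleR_left (g x i) o\<^sub>L blinfun_inner_left i)"
    using * by (intro Ck_on_sum assms Ck_on_bounded_linear[OF assms bounded_linear_rank_one]) auto
  then show "Ck_on k S g" by (simp flip: blinfun_rank_one_expansion)
qed

lemma differentiable_blinfunI:
  fixes g :: "'a::real_normed_vector \<Rightarrow> 'c::euclidean_space \<Rightarrow>\<^sub>L 'b::real_normed_vector"
  assumes "\<And>v. (\<lambda>x. g x v) differentiable (at x)"
  shows "g differentiable (at x)"
proof -
  have "(\<lambda>x. \<Sum>i\<in>Basis. blinfun_scaleR_left (g x i) o\<^sub>L blinfun_inner_left i) differentiable (at x)"
    by (rule differentiable_sum)
      (auto intro: differentiable_bounded_linear[OF bounded_linear_rank_one] assms)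
  then show ?thesis by (simp flip: blinfun_rank_one_expansion)
qed

lemma dir_deriv_blinfun_apply:
  assumes "g differentiable (at x)"
  shows "dir_deriv u (\<lambda>x. blinfun_apply (g x) v) x = blinfun_apply (dir_deriv u g x) v"
  by (rule dir_deriv_bounded_linear[OF bounded_linear_apply_blinfun assms])

lemma Ck_on_Suc_iff_frechet:
  fixes f :: "'a::euclidean_space \<Rightarrow> 'b::real_normed_vector"
  assumes "open S"
  shows "Ck_on (Suc k) S f \<longleftrightarrow> (\<forall>x\<in>S. f differentiable (at x)) \<and> Ck_on k S (frechet f)"
proof -
  have "Ck_on k S (\<lambda>x. frechet f x v) \<longleftrightarrow> Ck_on k S (dir_deriv v f)"
    if "\<forall>x\<in>S. f differentiable (at x)" for v
    using that Ck_on_cong[OF assms, of "\<lambda>x. frechet f x v" "dir_deriv v f"]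
      Ck_on_cong[OF assms, of "dir_deriv v f" "\<lambda>x. frechet f x v"]
    by (auto simp: frechet_apply)
  then show ?thesis by (auto simp: Ck_on_blinfun_iff[OF assms, of k "frechet f"])
qed

lemma C1_on_iff:
  fixes f :: "'a::euclidean_space \<Rightarrow> 'b::real_normed_vector"
  shows "open S \<Longrightarrow> C1_on S f \<longleftrightarrow> Ck_on 1 S f"
  unfolding One_nat_def by (subst Ck_on_Suc_iff_frechet) (simp_all add: C1_on_def)

lemma C2_on_iff:
  fixes f :: "'a::euclidean_space \<Rightarrow> 'b::real_normed_vector"
  shows "open S \<Longrightarrow> C2_on S f \<longleftrightarrow> Ck_on 2 S f"
  unfolding Suc_1[symmetric] by (subst Ck_on_Suc_iff_frechet) (simp_all add: C2_on_def C1_on_iff)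

lemma C3_on_iff:
  fixes f :: "'a::euclidean_space \<Rightarrow> 'b::real_normed_vector"
  shows "open S \<Longrightarrow> C3_on S f \<longleftrightarrow> Ck_on 3 S f"
  unfolding numeral_3_eq_3 numeral_2_eq_2[symmetric]
  by (subst Ck_on_Suc_iff_frechet) (simp_all add: C3_on_def C2_on_iff)

lemma C4_on_iff:
  fixes f :: "'a::euclidean_space \<Rightarrow> 'b::real_normed_vector"
  assumes "open S" shows "C4_on S f \<longleftrightarrow> Ck_on 4 S f"
  using Ck_on_Suc_iff_frechet[OF assms, of 3 f] by (simp add: C4_on_def C3_on_iff[OF assms])

lemma C5_on_iff:
  fixes f :: "'a::euclidean_space \<Rightarrow> 'b::real_normed_vector"
  assumes "open S" shows "C5_on S f \<longleftrightarrow> Ck_on 5 S f"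
  using Ck_on_Suc_iff_frechet[OF assms, of 4 f] by (simp add: C5_on_def C4_on_iff[OF assms])

section \<open>Inversion of operators\<close>

text \<open>
  The inverse of a bijective operator as an operator; meaningless if the function inverse is not
  bounded and linear.
\<close>

definition blinfun_inv :: "('a::real_normed_vector \<Rightarrow>\<^sub>L 'b::real_normed_vector) \<Rightarrow> ('b \<Rightarrow>\<^sub>L 'a)"
  where "blinfun_inv T = Blinfun (inv (blinfun_apply T))"

lemma blinfun_inv_apply:
  fixes T :: "'a::euclidean_space \<Rightarrow>\<^sub>L 'a"
  assumes "bij (blinfun_apply T)"
  shows "blinfun_apply (blinfun_inv T) = inv (blinfun_apply T)"
proof -
  have "linear (blinfun_apply T)"
    by (simp add: blinfun.bounded_linear_right bounded_linear.linear)
  from linear_injective_isomorphism[OF this bij_is_inj[OF assms]]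
  obtain g where g: "linear g" "\<forall>x. g (T x) = x" "\<forall>x. T (g x) = x" by blast
  then have "inv (blinfun_apply T) = g" using inv_unique_comp by (metis comp_apply ext id_apply)
  then show ?thesis
    using g(1) by (simp add: blinfun_inv_def bounded_linear_Blinfun_apply linear_conv_bounded_linear)
qed

context
  fixes T :: "'a::euclidean_space \<Rightarrow>\<^sub>L 'a"
  assumes bij: "bij (blinfun_apply T)"
begin

lemma blinfun_inv_left [simp]: "blinfun_inv T (T x) = x"
  using bij by (simp add: blinfun_inv_apply bij_is_inj)

lemma blinfun_inv_right [simp]: "T (blinfun_inv T x) = x"
  using bij by (simp add: blinfun_inv_apply bij_is_surj surj_f_inv_f)

text \<open>
  The operators near an invertible one are invertible, with uniformly bounded inverses: the lower bound
  $\|x\| \le b \|Tx\|$ survives a perturbation of size less than $1/(2b)$ with constant $2b$, and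
  injectivity suffices for bijectivity in finite dimension.
\<close>

lemma blinfun_inv_perturbation:
  obtains d M where "d > 0" "M \<ge> 0"
    "\<And>T'. norm (T' - T) < d \<Longrightarrow> bij (blinfun_apply T') \<and> norm (blinfun_inv T') \<le> M"
proof -
  define b where "b = norm (blinfun_inv T) + 1"
  have b: "b > 0" by (simp add: b_def add_nonneg_pos)
  have lower: "norm x \<le> b * norm (T x)" for x
  proof -
    have "norm x \<le> norm (blinfun_inv T) * norm (T x)"
      using norm_blinfun[of "blinfun_inv T" "T x"] by simp
    also have "\<dots> \<le> b * norm (T x)" by (rule mult_right_mono) (simp_all add: b_def)
    finally show ?thesis .
  qed
  have main: "bij (blinfun_apply T') \<and> norm (blinfun_inv T') \<le> 2 * b"
    if T': "norm (T' - T) < 1 / (2 * b)" for T'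
  proof -
    have lower': "norm x \<le> 2 * b * norm (T' x)" for x
    proof -
      have "norm (T x) \<le> norm (T' x) + norm ((T' - T) x)"
        using norm_triangle_sub[of "T x" "T' x"] by (simp add: blinfun.diff_left norm_minus_commute)
      also have "norm ((T' - T) x) \<le> norm (T' - T) * norm x" by (rule norm_blinfun)
      also have "\<dots> \<le> 1 / (2 * b) * norm x" using T' by (intro mult_right_mono) auto
      finally have "b * norm (T x) \<le> b * (norm (T' x) + 1 / (2 * b) * norm x)"
        using b by (intro mult_left_mono) auto
      also have "b * (norm (T' x) + 1 / (2 * b) * norm x) = b * norm (T' x) + norm x / 2"
        using b by (simp add: field_simps)
      finally show ?thesis using lower[of x] by simp
    qed
    have lin: "linear (blinfun_apply T')"
      by (simp add: blinfun.bounded_linear_right bounded_linear.linear)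
    have "x = 0" if "T' x = 0" for x using lower'[of x] that by simp
    then have "inj (blinfun_apply T')" unfolding linear_injective_0[OF lin] by blast
    then have bij': "bij (blinfun_apply T')"
      using linear_injective_imp_surjective[OF lin] by (simp add: bij_def)
    have "norm (blinfun_inv T' y) \<le> 2 * b * norm y" for y
      using lower'[of "blinfun_inv T' y"] bij'
      by (simp add: blinfun_inv_apply bij_is_surj surj_f_inv_f)
    then have "norm (blinfun_inv T') \<le> 2 * b" using b by (intro norm_blinfun_bound) auto
    with bij' show ?thesis by simp
  qed
  show ?thesis by (rule that[of "1 / (2 * b)" "2 * b"]) (use b main in auto)
qed

end

lemma blinfun_inv_diff:
  fixes S T :: "'a::euclidean_space \<Rightarrow>\<^sub>L 'a"
  assumes "bij (blinfun_apply S)" "bij (blinfun_apply T)"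
  shows "blinfun_inv S - blinfun_inv T = - (blinfun_inv S o\<^sub>L ((S - T) o\<^sub>L blinfun_inv T))"
  using assms by (intro blinfun_eqI)
    (simp add: blinfun.diff_left blinfun.diff_right blinfun.minus_left)

lemma open_bij_blinfun: "open {T :: 'a::euclidean_space \<Rightarrow>\<^sub>L 'a. bij (blinfun_apply T)}"
  unfolding open_dist
proof (intro ballI)
  fix T :: "'a \<Rightarrow>\<^sub>L 'a" assume "T \<in> {T. bij (blinfun_apply T)}"
  then have "bij (blinfun_apply T)" by simp
  from blinfun_inv_perturbation[OF this] obtain d where
    "d > 0" "\<And>T'. norm (T' - T) < d \<Longrightarrow> bij (blinfun_apply T')" by metis
  then show "\<exists>e>0. \<forall>y. dist y T < e \<longrightarrow> y \<in> {T. bij (blinfun_apply T)}"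
    by (auto simp: dist_norm)
qed

lemma isCont_blinfun_inv:
  fixes T :: "'a::euclidean_space \<Rightarrow>\<^sub>L 'a"
  assumes "bij (blinfun_apply T)"
  shows "isCont blinfun_inv T"
proof -
  obtain d M where d: "d > 0" "M \<ge> 0"
    "\<And>T'. norm (T' - T) < d \<Longrightarrow> bij (blinfun_apply T') \<and> norm (blinfun_inv T') \<le> M"
    using blinfun_inv_perturbation[OF assms] by metis
  have "((\<lambda>T'. blinfun_inv T' - blinfun_inv T) \<longlongrightarrow> 0) (at T)"
  proof (rule Lim_null_comparison)
    show "\<forall>\<^sub>F T' in at T. norm (blinfun_inv T' - blinfun_inv T)
        \<le> M * (norm (T' - T) * norm (blinfun_inv T))"
      unfolding eventually_at
    proof (intro exI[of _ d] conjI ballI impI d)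
      fix T' :: "'a \<Rightarrow>\<^sub>L 'a" assume "T' \<noteq> T \<and> dist T' T < d"
      then have T': "bij (blinfun_apply T')" "norm (blinfun_inv T') \<le> M"
        using d(3)[of T'] by (auto simp: dist_norm)
      have "norm (blinfun_inv T' - blinfun_inv T)
        = norm (blinfun_inv T' o\<^sub>L ((T' - T) o\<^sub>L blinfun_inv T))"
        by (simp add: blinfun_inv_diff[OF T'(1) assms])
      also have "\<dots> \<le> norm (blinfun_inv T') * norm ((T' - T) o\<^sub>L blinfun_inv T)"
        by (rule norm_blinfun_compose)
      also have "\<dots> \<le> M * (norm (T' - T) * norm (blinfun_inv T))"
        using T'(2) d(2) by (intro mult_mono norm_blinfun_compose) auto
      finally show "norm (blinfun_inv T' - blinfun_inv T)
        \<le> M * (norm (T' - T) * norm (blinfun_inv T))" .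
    qed
    have "((\<lambda>T'. M * (norm (T' - T) * norm (blinfun_inv T)))
        \<longlongrightarrow> M * (norm (T - T) * norm (blinfun_inv T))) (at T)"
      by (intro tendsto_intros)
    then show "((\<lambda>T'. M * (norm (T' - T) * norm (blinfun_inv T))) \<longlongrightarrow> 0) (at T)" by simp
  qed
  then show ?thesis unfolding isCont_def by (rule Lim_null[THEN iffD2])
qed

lemma has_derivative_blinfun_inv:
  fixes T :: "'b::real_normed_vector \<Rightarrow> 'a::euclidean_space \<Rightarrow>\<^sub>L 'a"
  assumes "open S" "x \<in> S" and T: "(T has_derivative T') (at x)"
    and bij: "\<And>y. y \<in> S \<Longrightarrow> bij (blinfun_apply (T y))"
  shows "((\<lambda>y. blinfun_inv (T y)) has_derivative
    (\<lambda>v. - (blinfun_inv (T x) o\<^sub>L (T' v o\<^sub>L blinfun_inv (T x))))) (at x)"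
proof -
  have "isCont (\<lambda>y. blinfun_inv (T y)) x"
    using isCont_o2[OF has_derivative_continuous[OF T] isCont_blinfun_inv[OF bij[OF assms(2)]]] .
  moreover have "((\<lambda>y. (T y - T x) o\<^sub>L blinfun_inv (T x)) has_derivative
      (\<lambda>v. T' v o\<^sub>L blinfun_inv (T x))) (at x)"
    using T by (auto intro!: derivative_eq_intros)
  \<comment> \<open>In the product of \<open>blinfun_inv (T y)\<close> and \<open>(T y - T x) o\<^sub>L blinfun_inv (T x)\<close> the second factor
    vanishes at \<open>x\<close>, so continuity of the first is enough.\<close>
  ultimately have "((\<lambda>y. blinfun_inv (T y) o\<^sub>L ((T y - T x) o\<^sub>L blinfun_inv (T x))) has_derivative
      (\<lambda>v. blinfun_inv (T x) o\<^sub>L (T' v o\<^sub>L blinfun_inv (T x)))) (at x)"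
    by (rule has_derivative_bilinear_vanishing[OF bounded_bilinear_blinfun_compose]) simp
  from has_derivative_diff[OF has_derivative_const this]
  have "((\<lambda>y. blinfun_inv (T x) - (blinfun_inv (T y) o\<^sub>L ((T y - T x) o\<^sub>L blinfun_inv (T x))))
      has_derivative (\<lambda>v. - (blinfun_inv (T x) o\<^sub>L (T' v o\<^sub>L blinfun_inv (T x))))) (at x)"
    by simp
  then show ?thesis
  proof (rule has_derivative_transform_within_open[OF _ assms(1,2)])
    fix y assume "y \<in> S"
    then show "blinfun_inv (T x) - (blinfun_inv (T y) o\<^sub>L ((T y - T x) o\<^sub>L blinfun_inv (T x)))
      = blinfun_inv (T y)"
      using blinfun_inv_diff[OF bij bij, of y x] assms(2) by (simp add: algebra_simps)
  qed
qed

lemma Ck_on_blinfun_inv: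
  fixes T :: "'b::real_normed_vector \<Rightarrow> 'a::euclidean_space \<Rightarrow>\<^sub>L 'a"
  assumes "open S" and bij: "\<And>y. y \<in> S \<Longrightarrow> bij (blinfun_apply (T y))" and "Ck_on k S T"
  shows "Ck_on k S (\<lambda>y. blinfun_inv (T y))"
  using assms(3)
proof (induction k)
  case 0
  then have "isCont T y" if "y \<in> S" for y
    using assms(1) that by (simp add: continuous_on_eq_continuous_at)
  then have "isCont (\<lambda>y. blinfun_inv (T y)) y" if "y \<in> S" for y
    by (rule isCont_o2[of y T blinfun_inv]) (use that isCont_blinfun_inv[OF bij] in auto)
  then show ?case by (simp add: continuous_at_imp_continuous_on)
next
  case (Suc k)
  have IH: "Ck_on k S (\<lambda>y. blinfun_inv (T y))"
    by (rule Suc.IH[OF Ck_on_pred[OF Suc.prems]])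
  have D: "((\<lambda>y. blinfun_inv (T y)) has_derivative
      (\<lambda>v. - (blinfun_inv (T x) o\<^sub>L (dir_deriv v T x o\<^sub>L blinfun_inv (T x))))) (at x)"
    if "x \<in> S" for x
    by (rule has_derivative_blinfun_inv[OF assms(1) that _ bij])
      (auto intro!: has_derivative_dir_deriv Ck_on_imp_differentiable[OF Suc.prems that])
  have "Ck_on k S (dir_deriv v (\<lambda>y. blinfun_inv (T y)))" for v
  proof (rule Ck_on_cong[OF assms(1)])
    show "Ck_on k S (\<lambda>y. - (blinfun_inv (T y) o\<^sub>L (dir_deriv v T y o\<^sub>L blinfun_inv (T y))))"
      by (intro Ck_on_minus Ck_on_bilinear[OF _ bounded_bilinear_blinfun_compose] IH assms(1)
          Ck_on_dir_deriv[OF Suc.prems])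
  qed (simp add: dir_deriv_eq[OF D])
  moreover have "\<forall>x\<in>S. (\<lambda>y. blinfun_inv (T y)) differentiable (at x)"
    using D unfolding differentiable_def by blast
  ultimately show ?case by simp
qed

section \<open>Symmetry of second derivatives and Taylor's formula\<close>

lemma norm_diff_le_on_interval:
  fixes f :: "real \<Rightarrow> 'b::real_normed_vector"
  assumes "\<And>t. t \<in> {0..s} \<Longrightarrow> (f has_vector_derivative f' t) (at t)"
    and "\<And>t. t \<in> {0..s} \<Longrightarrow> norm (f' t) \<le> B" and "t \<in> {0..s}"
  shows "norm (f t - f 0) \<le> B * t"
proof -
  have "norm (f t - f 0) \<le> B * norm (t - 0)"
  proof (rule differentiable_bound[of "{0..s}" f "\<lambda>t h. h *\<^sub>R f' t"])
    show "(f has_derivative (\<lambda>h. h *\<^sub>R f' t)) (at t within {0..s})" if "t \<in> {0..s}" for t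
      using assms(1)[OF that] has_derivative_at_withinI unfolding has_vector_derivative_def by blast
    show "onorm (\<lambda>h. h *\<^sub>R f' t) \<le> B" if "t \<in> {0..s}" for t
      using assms(2)[OF that] by (intro onorm_le) (simp add: mult.commute[of B] mult_left_mono)
  qed (use assms(3) in auto)
  then show ?thesis using assms(3) by simp
qed

lemma has_vector_derivative_line:
  assumes "f differentiable (at (x + t *\<^sub>R u))"
  shows "((\<lambda>t. f (x + t *\<^sub>R u)) has_vector_derivative dir_deriv u f (x + t *\<^sub>R u)) (at t)"
proof -
  have "((\<lambda>t. x + t *\<^sub>R u) has_derivative (\<lambda>h. h *\<^sub>R u)) (at t)"
    by (auto intro!: derivative_eq_intros)
  from has_derivative_compose[OF this has_derivative_dir_deriv[OF assms]]
  have "((\<lambda>t. f (x + t *\<^sub>R u)) has_derivative (\<lambda>h. dir_deriv (h *\<^sub>R u) f (x + t *\<^sub>R u))) (at t)" .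
  moreover have "dir_deriv (h *\<^sub>R u) f (x + t *\<^sub>R u) = h *\<^sub>R dir_deriv u f (x + t *\<^sub>R u)" for h
    by (rule linear_cmul[OF bounded_linear.linear[OF
            has_derivative_bounded_linear[OF has_derivative_dir_deriv[OF assms]]]])
  ultimately show ?thesis by (simp add: has_vector_derivative_def)
qed

text \<open>
  The second difference of \<open>f\<close> along \<open>u\<close> and \<open>v\<close>, divided by $s^2$, is close to the mixed derivative.
  Applying the mean value inequality in the direction \<open>v\<close> and then in the direction \<open>u\<close> gives this for
  one order of differentiation. The second difference is symmetric in \<open>u\<close> and \<open>v\<close>, so
  exchanging the roles of \<open>u\<close> and \<open>v\<close> yields the symmetry of the second derivative.
\<close>

lemma second_difference_bound:
  fixes f :: "'a::real_normed_vector \<Rightarrow> 'b::real_normed_vector"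
  assumes "open S" "x \<in> S" and f: "Ck_on 2 S f" and "e > 0"
  shows "\<exists>d>0. \<forall>s. 0 < s \<and> s < d \<longrightarrow>
    norm (f (x + s *\<^sub>R v + s *\<^sub>R u) - f (x + s *\<^sub>R u) - f (x + s *\<^sub>R v) + f x
      - s\<^sup>2 *\<^sub>R dir_deriv v (dir_deriv u f) x) \<le> s\<^sup>2 * e"
proof -
  define c where "c = dir_deriv v (dir_deriv u f) x"
  have f': "Ck_on (Suc (Suc 0)) S f" using f by (simp add: numeral_2_eq_2)
  have d1: "f differentiable (at y)" if "y \<in> S" for y
    using f' that by simp
  have d2: "dir_deriv u f differentiable (at y)" if "y \<in> S" for y
    using f' that by simp
  have "continuous_on S (dir_deriv v (dir_deriv u f))"
    using f' by simp
  then have "isCont (dir_deriv v (dir_deriv u f)) x"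
    using assms(1,2) by (simp add: continuous_on_eq_continuous_at)
  then obtain r where r: "r > 0" "\<And>y. dist y x < r \<Longrightarrow> norm (dir_deriv v (dir_deriv u f) y - c) < e"
    using \<open>e > 0\<close> unfolding continuous_at_eps_delta c_def dist_norm[symmetric] by metis
  obtain r' where r': "r' > 0" "\<And>y. dist y x < r' \<Longrightarrow> y \<in> S"
    using assms(1,2) unfolding open_dist by blast
  define \<rho> where "\<rho> = min r r'"
  define d where "d = \<rho> / (norm u + norm v + 1)"
  have pos: "norm u + norm v + 1 > 0" by (simp add: add_nonneg_pos)
  have "d > 0" using r r' pos by (simp add: d_def \<rho>_def)
  moreover have "norm (f (x + s *\<^sub>R v + s *\<^sub>R u) - f (x + s *\<^sub>R u) - f (x + s *\<^sub>R v) + f x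
      - s\<^sup>2 *\<^sub>R c) \<le> s\<^sup>2 * e" if s: "0 < s" "s < d" for s
  proof -
    have near: "dist (x + a *\<^sub>R u + b *\<^sub>R v) x < \<rho>" if "a \<in> {0..s}" "b \<in> {0..s}" for a b
    proof -
      have "dist (x + a *\<^sub>R u + b *\<^sub>R v) x \<le> a * norm u + b * norm v"
        using that norm_triangle_ineq[of "a *\<^sub>R u" "b *\<^sub>R v"] by (simp add: dist_norm algebra_simps)
      also have "\<dots> \<le> s * norm u + s * norm v"
        using that by (intro add_mono mult_right_mono) auto
      also have "\<dots> \<le> s * (norm u + norm v + 1)"
        using s by (simp add: algebra_simps)
      also have "\<dots> < d * (norm u + norm v + 1)"
        using s pos by (intro mult_strict_right_mono)
      finally show ?thesis using pos by (simp add: d_def)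
    qed
    then have inS: "x + a *\<^sub>R u + b *\<^sub>R v \<in> S" if "a \<in> {0..s}" "b \<in> {0..s}" for a b
      using that r'(2) unfolding \<rho>_def by (meson min_less_iff_conj)
    have inner: "norm (dir_deriv u f (x + a *\<^sub>R u + s *\<^sub>R v) - dir_deriv u f (x + a *\<^sub>R u) - s *\<^sub>R c)
        \<le> e * s" if a: "a \<in> {0..s}" for a
    proof -
      let ?p = "\<lambda>t. dir_deriv u f (x + a *\<^sub>R u + t *\<^sub>R v) - t *\<^sub>R c"
      have "norm (?p s - ?p 0) \<le> e * s"
      proof (rule norm_diff_le_on_interval)
        fix t assume t: "t \<in> {0..s}"
        show "(?p has_vector_derivative
            dir_deriv v (dir_deriv u f) (x + a *\<^sub>R u + t *\<^sub>R v) - c) (at t)"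
          by (intro has_vector_derivative_diff has_vector_derivative_line d2 inS a t)
            (auto intro!: derivative_eq_intros)
        show "norm (dir_deriv v (dir_deriv u f) (x + a *\<^sub>R u + t *\<^sub>R v) - c) \<le> e"
          using near[OF a t] r(2) by (auto simp: \<rho>_def intro: less_imp_le)
      qed (use s in auto)
      then show ?thesis by (simp add: algebra_simps)
    qed
    let ?q = "\<lambda>t. f (x + s *\<^sub>R v + t *\<^sub>R u) - f (x + t *\<^sub>R u) - t *\<^sub>R s *\<^sub>R c"
    have "norm (?q s - ?q 0) \<le> (e * s) * s"
    proof (rule norm_diff_le_on_interval)
      fix t assume t: "t \<in> {0..s}"
      have *: "x + s *\<^sub>R v + t *\<^sub>R u \<in> S" "x + t *\<^sub>R u \<in> S"
        using inS[of t s] inS[of t 0] t s by (auto simp: algebra_simps)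
      show "(?q has_vector_derivative
          dir_deriv u f (x + s *\<^sub>R v + t *\<^sub>R u) - dir_deriv u f (x + t *\<^sub>R u) - s *\<^sub>R c) (at t)"
        by (intro has_vector_derivative_diff has_vector_derivative_line d1 *)
          (auto intro!: derivative_eq_intros)
      show "norm (dir_deriv u f (x + s *\<^sub>R v + t *\<^sub>R u) - dir_deriv u f (x + t *\<^sub>R u) - s *\<^sub>R c)
          \<le> e * s"
        using inner[OF t] by (simp add: algebra_simps)
    qed (use s in auto)
    then show ?thesis by (simp add: algebra_simps power2_eq_square)
  qed
  ultimately show ?thesis unfolding c_def by blast
qed

lemma dir_deriv_commute:
  fixes f :: "'a::real_normed_vector \<Rightarrow> 'b::real_normed_vector"
  assumes "open S" "x \<in> S" and f: "Ck_on 2 S f"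
  shows "dir_deriv u (dir_deriv v f) x = dir_deriv v (dir_deriv u f) x"
proof (rule ccontr)
  let ?a = "dir_deriv v (dir_deriv u f) x" and ?b = "dir_deriv u (dir_deriv v f) x"
  assume "?b \<noteq> ?a"
  define e where "e = norm (?a - ?b) / 3"
  have "e > 0" using \<open>?b \<noteq> ?a\<close> by (simp add: e_def)
  obtain d1 where d1: "d1 > 0" "\<And>s. 0 < s \<Longrightarrow> s < d1 \<Longrightarrow>
    norm (f (x + s *\<^sub>R v + s *\<^sub>R u) - f (x + s *\<^sub>R u) - f (x + s *\<^sub>R v) + f x - s\<^sup>2 *\<^sub>R ?a) \<le> s\<^sup>2 * e"
    using second_difference_bound[OF assms \<open>e > 0\<close>, of v u] by blast
  obtain d2 where d2: "d2 > 0" "\<And>s. 0 < s \<Longrightarrow> s < d2 \<Longrightarrow>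
    norm (f (x + s *\<^sub>R u + s *\<^sub>R v) - f (x + s *\<^sub>R v) - f (x + s *\<^sub>R u) + f x - s\<^sup>2 *\<^sub>R ?b) \<le> s\<^sup>2 * e"
    using second_difference_bound[OF assms \<open>e > 0\<close>, of u v] by blast
  define s where "s = min d1 d2 / 2"
  have s: "0 < s" "s < d1" "s < d2" using d1 d2 by (auto simp: s_def)
  let ?D = "f (x + s *\<^sub>R v + s *\<^sub>R u) - f (x + s *\<^sub>R u) - f (x + s *\<^sub>R v) + f x"
  have "norm (?D - s\<^sup>2 *\<^sub>R ?a) \<le> s\<^sup>2 * e" by (rule d1(2)[OF s(1,2)])
  moreover have "norm (?D - s\<^sup>2 *\<^sub>R ?b) \<le> s\<^sup>2 * e"
    using d2(2)[OF s(1,3)] by (simp add: algebra_simps)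
  ultimately have "norm ((?D - s\<^sup>2 *\<^sub>R ?b) - (?D - s\<^sup>2 *\<^sub>R ?a)) \<le> s\<^sup>2 * e + s\<^sup>2 * e"
    by (meson norm_triangle_le_diff add_mono order_trans add.commute)
  also have "(?D - s\<^sup>2 *\<^sub>R ?b) - (?D - s\<^sup>2 *\<^sub>R ?a) = s\<^sup>2 *\<^sub>R (?a - ?b)"
    by (simp add: algebra_simps)
  finally have "s\<^sup>2 * (3 * e) \<le> s\<^sup>2 * (2 * e)" by (simp add: e_def)
  then show False using s \<open>e > 0\<close> by simp
qed

lemma frechet2_apply:
  fixes f :: "'a::euclidean_space \<Rightarrow> 'b::real_normed_vector"
  assumes "open S" "x \<in> S" and f: "Ck_on 2 S f"
  shows "frechet f differentiable (at x)"
    and "frechet (frechet f) x u v = dir_deriv u (dir_deriv v f) x"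
proof -
  have f1: "Ck_on 1 S (frechet f)" and f0: "\<forall>x\<in>S. f differentiable (at x)"
    using f Ck_on_Suc_iff_frechet[OF assms(1), of 1 f] by (auto simp: numeral_2_eq_2)
  show diff: "frechet f differentiable (at x)" using f1 assms(2) by simp
  have "frechet (frechet f) x u v = dir_deriv u (\<lambda>y. frechet f y v) x"
    by (simp add: frechet_apply[OF diff] dir_deriv_blinfun_apply[OF diff])
  also have "\<dots> = dir_deriv u (dir_deriv v f) x"
    using f0 by (intro dir_deriv_cong[OF assms(1) _ assms(2)])
      (auto simp: frechet_apply intro!: differentiable_bounded_linear[OF bounded_linear_apply_blinfun] diff)
  finally show "frechet (frechet f) x u v = dir_deriv u (dir_deriv v f) x" .
qed

lemma differentiable_frechet2I:
  fixes f :: "'a::euclidean_space \<Rightarrow> 'b::real_normed_vector"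
  assumes "open S" "x \<in> S" and f: "Ck_on 2 S f"
    and diff: "\<And>u v. dir_deriv u (dir_deriv v f) differentiable (at x)"
  shows "frechet (frechet f) differentiable (at x)"
  by (intro differentiable_blinfunI differentiable_cong_open[OF assms(1) _ assms(2) diff])
    (simp add: frechet2_apply[OF assms(1) _ f])

lemma frechet3_apply:
  fixes f :: "'a::euclidean_space \<Rightarrow> 'b::real_normed_vector"
  assumes "open S" "x \<in> S" and f: "Ck_on 2 S f"
    and diff: "frechet (frechet f) differentiable (at x)"
  shows "frechet (frechet (frechet f)) x w u v = dir_deriv w (dir_deriv u (dir_deriv v f)) x"
proof -
  have 1: "(\<lambda>y. frechet (frechet f) y u) differentiable (at x)"
    by (rule differentiable_bounded_linear[OF bounded_linear_apply_blinfun diff])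
  have 2: "(\<lambda>y. frechet (frechet f) y u v) differentiable (at x)"
    by (rule differentiable_bounded_linear[OF bounded_linear_apply_blinfun 1])
  have "frechet (frechet (frechet f)) x w u v = dir_deriv w (\<lambda>y. frechet (frechet f) y u v) x"
    by (simp add: frechet_apply[OF diff] dir_deriv_blinfun_apply[OF diff]
        dir_deriv_blinfun_apply[OF 1])
  also have "\<dots> = dir_deriv w (dir_deriv u (dir_deriv v f)) x"
    by (rule dir_deriv_cong[OF assms(1) _ assms(2) 2]) (simp add: frechet2_apply[OF assms(1) _ f])
  finally show ?thesis .
qed

text \<open>
  Third-order Taylor formula with Peano remainder, for a $C^2$ map whose second derivative is
  differentiable at the single point \<open>x\<close>. On a segment, $D^2 f(x+th)[h,h]$ differs from its first-order
  expansion by at most $e\|h\|^3$, and integrating twice in $t$ keeps this bound.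
\<close>

lemma taylor_young_3:
  fixes f :: "'a::euclidean_space \<Rightarrow> 'b::real_normed_vector"
  assumes "open S" "x \<in> S" and f: "Ck_on 2 S f"
    and diff: "frechet (frechet f) differentiable (at x)" and "e > 0"
  shows "\<exists>d>0. \<forall>h. norm h < d \<longrightarrow>
    norm (f (x + h) - f x - frechet f x h - (1/2) *\<^sub>R frechet (frechet f) x h h
      - (1/6) *\<^sub>R frechet (frechet (frechet f)) x h h h) \<le> e * norm h ^ 3"
proof -
  define D2 where "D2 = frechet (frechet f)"
  define D3 where "D3 = frechet D2 x"
  have f0: "f differentiable (at y)" and f1: "dir_deriv v f differentiable (at y)"
    if "y \<in> S" for y v
    using f that by (auto simp: numeral_2_eq_2)
  have "blinfun_apply D3 = (\<lambda>v. dir_deriv v D2 x)"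
    unfolding D2_def D3_def by (rule ext) (rule frechet_apply[OF diff])
  then have "(D2 has_derivative D3) (at x)"
    using has_derivative_dir_deriv[OF diff] by (simp add: D2_def)
  then obtain d1 where d1: "d1 > 0"
    "\<And>y. norm (y - x) < d1 \<Longrightarrow> norm (D2 y - D2 x - D3 (y - x)) \<le> e * norm (y - x)"
    using \<open>e > 0\<close> unfolding has_derivative_at_alt by blast
  obtain d2 where d2: "d2 > 0" "\<And>y. dist y x < d2 \<Longrightarrow> y \<in> S"
    using assms(1,2) unfolding open_dist by blast
  have "norm (f (x + h) - f x - frechet f x h - (1/2) *\<^sub>R D2 x h h
      - (1/6) *\<^sub>R D3 h h h) \<le> e * norm h ^ 3" if h: "norm h < min d1 d2" for h
  proof -
    let ?E = "e * norm h ^ 3"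
    have th: "norm (t *\<^sub>R h) \<le> norm h" if "t \<in> {0..1}" for t
      using that by (simp add: mult_left_le_one_le)
    have inS: "x + t *\<^sub>R h \<in> S" if "t \<in> {0..1}" for t
      using d2(2)[of "x + t *\<^sub>R h"] th[OF that] h by (simp add: dist_norm)
    have second: "norm (D2 (x + t *\<^sub>R h) h h - D2 x h h - t *\<^sub>R D3 h h h) \<le> ?E"
      if t: "t \<in> {0..1}" for t
    proof -
      let ?R = "D2 (x + t *\<^sub>R h) - D2 x - D3 (t *\<^sub>R h)"
      have "norm ?R \<le> e * norm h"
        using d1(2)[of "x + t *\<^sub>R h"] th[OF t] h \<open>e > 0\<close>
        by (simp add: order_trans[OF _ mult_left_mono])
      have "norm (?R h h) \<le> norm (?R h) * norm h" by (rule norm_blinfun)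
      also have "\<dots> \<le> (norm ?R * norm h) * norm h"
        by (intro mult_right_mono norm_blinfun) simp
      also have "\<dots> \<le> (e * norm h * norm h) * norm h"
        using \<open>norm ?R \<le> e * norm h\<close> by (intro mult_right_mono) auto
      finally show ?thesis
        by (simp add: blinfun.diff_left blinfun.scaleR_right blinfun.scaleR_left power3_eq_cube
            mult.assoc)
    qed
    \<comment> \<open>\<open>?k\<close> is the Taylor remainder along the segment, and \<open>?g t - ?g 0\<close> is its derivative.\<close>
    let ?g = "\<lambda>t. dir_deriv h f (x + t *\<^sub>R h) - t *\<^sub>R D2 x h h - (t^2/2) *\<^sub>R D3 h h h"
    have first: "norm (?g t - ?g 0) \<le> ?E" if t: "t \<in> {0..1}" for t
    proof -
      have "norm (?g t - ?g 0) \<le> ?E * t"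
      proof (rule norm_diff_le_on_interval[OF _ second t])
        fix t :: real assume t: "t \<in> {0..1}"
        have "((\<lambda>t. dir_deriv h f (x + t *\<^sub>R h)) has_vector_derivative D2 (x + t *\<^sub>R h) h h) (at t)"
          unfolding D2_def frechet2_apply(2)[OF assms(1) inS[OF t] f]
          by (rule has_vector_derivative_line[OF f1[OF inS[OF t]]])
        then show "(?g has_vector_derivative D2 (x + t *\<^sub>R h) h h - D2 x h h - t *\<^sub>R D3 h h h) (at t)"
          by (auto intro!: derivative_eq_intros)
      qed
      also have "\<dots> \<le> ?E * 1" using t \<open>e > 0\<close> by (intro mult_left_mono) auto
      finally show ?thesis by simp
    qed
    let ?k = "\<lambda>t. f (x + t *\<^sub>R h) - t *\<^sub>R dir_deriv h f x - (t^2/2) *\<^sub>R D2 x h h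
      - (t^3/6) *\<^sub>R D3 h h h"
    have "norm (?k 1 - ?k 0) \<le> ?E * 1"
    proof (rule norm_diff_le_on_interval[OF _ first])
      fix t :: real assume t: "t \<in> {0..1}"
      have "((\<lambda>t. f (x + t *\<^sub>R h)) has_vector_derivative dir_deriv h f (x + t *\<^sub>R h)) (at t)"
        by (rule has_vector_derivative_line[OF f0[OF inS[OF t]]])
      then show "(?k has_vector_derivative ?g t - ?g 0) (at t)"
        by (auto intro!: derivative_eq_intros simp: power2_eq_square)
    qed auto
    then show ?thesis
      by (simp add: frechet_apply[OF f0[OF assms(2)]] algebra_simps)
  qed
  then show ?thesis using d1(1) d2(1) unfolding D2_def D3_def
    by (intro exI[of _ "min d1 d2"]) simp
qed

section \<open>Second and third derivatives of products\<close>

lemma scaleR_3: "3 *\<^sub>R x = x + x + (x :: 'b::real_vector)"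
  using scaleR_add_left[of 1 2 x] by (simp add: scaleR_2)

lemma dir_deriv2_bilinear:
  assumes "bounded_bilinear bop" "open S" "x \<in> S" and f: "Ck_on 2 S f" and g: "Ck_on 2 S g"
  shows "dir_deriv u (dir_deriv v (\<lambda>x. bop (f x) (g x))) x
    = bop (dir_deriv u (dir_deriv v f) x) (g x) + bop (dir_deriv v f x) (dir_deriv u g x)
    + (bop (dir_deriv u f x) (dir_deriv v g x) + bop (f x) (dir_deriv u (dir_deriv v g) x))"
proof -
  have d: "f differentiable (at y)" "g differentiable (at y)"
    "dir_deriv v f differentiable (at y)" "dir_deriv v g differentiable (at y)" if "y \<in> S" for y
    using f g that by (auto simp: numeral_2_eq_2)
  note D = d[OF assms(3)]
  note bil = differentiable_bilinear[OF assms(1)] dir_deriv_bilinear[OF assms(1)]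
  have "dir_deriv u (dir_deriv v (\<lambda>x. bop (f x) (g x))) x
    = dir_deriv u (\<lambda>y. bop (dir_deriv v f y) (g y) + bop (f y) (dir_deriv v g y)) x"
    by (rule dir_deriv_cong[OF assms(2) _ assms(3), symmetric])
      (simp_all add: bil d D differentiable_add)
  also have "\<dots> = bop (dir_deriv u (dir_deriv v f) x) (g x) + bop (dir_deriv v f x) (dir_deriv u g x)
    + (bop (dir_deriv u f x) (dir_deriv v g x) + bop (f x) (dir_deriv u (dir_deriv v g) x))"
    by (simp add: dir_deriv_add bil D)
  finally show ?thesis .
qed

text \<open>
  The second derivative of a product can be differentiated once more at a zero of the second factor,
  although the first factor is only $C^2$: its second derivative occurs only in a product with \<open>g\<close>,
  which vanishes at \<open>x\<close>.
\<close>

lemma has_derivative_dir_deriv2_bilinear_vanishing: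
  fixes f :: "'a::real_normed_vector \<Rightarrow> 'b::real_normed_vector"
    and g :: "'a \<Rightarrow> 'c::real_normed_vector" and bop :: "'b \<Rightarrow> 'c \<Rightarrow> 'd::real_normed_vector"
  assumes "bounded_bilinear bop" "open S" "x \<in> S" and f: "Ck_on 2 S f" and g: "Ck_on 2 S g"
    and "g x = 0" and g3: "dir_deriv u (dir_deriv v g) differentiable (at x)"
  shows "(dir_deriv u (dir_deriv v (\<lambda>x. bop (f x) (g x))) has_derivative
    (\<lambda>w. bop (dir_deriv u (dir_deriv v f) x) (dir_deriv w g x)
      + (bop (dir_deriv v f x) (dir_deriv w (dir_deriv u g) x)
        + bop (dir_deriv w (dir_deriv v f) x) (dir_deriv u g x))
      + ((bop (dir_deriv u f x) (dir_deriv w (dir_deriv v g) x)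
        + bop (dir_deriv w (dir_deriv u f) x) (dir_deriv v g x))
      + (bop (f x) (dir_deriv w (dir_deriv u (dir_deriv v g)) x)
        + bop (dir_deriv w f x) (dir_deriv u (dir_deriv v g) x))))) (at x)"
proof -
  have d: "f differentiable (at x)" "g differentiable (at x)"
    "dir_deriv v f differentiable (at x)" "dir_deriv v g differentiable (at x)" for v
    using f g assms(3) by (auto simp: numeral_2_eq_2)
  have "continuous_on S (dir_deriv u (dir_deriv v f))" using f by (simp add: numeral_2_eq_2)
  then have "isCont (dir_deriv u (dir_deriv v f)) x"
    using assms(2,3) by (simp add: continuous_on_eq_continuous_at)
  note 1 = has_derivative_bilinear_vanishing[OF assms(1) this has_derivative_dir_deriv[OF d(2)] assms(6)]
  note 2 = bounded_bilinear.FDERIV[OF assms(1) has_derivative_dir_deriv has_derivative_dir_deriv]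
  show ?thesis
    by (rule has_derivative_transform_within_open[OF has_derivative_add[OF
            has_derivative_add[OF 1 2[OF d(3) d(4)[of u]]]
            has_derivative_add[OF 2[OF d(3) d(4)] 2[OF d(1) g3]]] assms(2,3)])
      (simp add: dir_deriv2_bilinear[OF assms(1,2) _ f g])
qed

section \<open>The Halley map near a simple zero\<close>

text \<open>
  A $C^4$ map \<open>F\<close> on an open set \<open>S\<close> with a simple zero \<open>Xs\<close>, on an arbitrary Euclidean space.
\<close>

locale halley_zero =
  fixes F :: "'a::euclidean_space \<Rightarrow> 'a" and S :: "'a set" and Xs :: 'a
  assumes open_S: "open S" and Xs_in_S: "Xs \<in> S" and C4: "Ck_on 4 S F"
    and zero: "simple_zero F Xs"
begin

abbreviation A where "A \<equiv> frechet F"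
abbreviation B where "B \<equiv> frechet (frechet F)"
abbreviation C where "C \<equiv> frechet (frechet (frechet F))"
abbreviation n where "n \<equiv> newton_step F"
abbreviation h where "h \<equiv> halley F"

text \<open>
  The operator $I + \frac12 L(x)$; it agrees with \<open>halley_op F x\<close> where \<open>A x\<close> is invertible.
\<close>

definition K :: "'a \<Rightarrow> 'a \<Rightarrow>\<^sub>L 'a"
  where "K x = id_blinfun + (1/2) *\<^sub>R (blinfun_inv (A x) o\<^sub>L B x (n x))"

text \<open>
  The neighbourhood on which the Halley map is studied: all points of \<open>S\<close> at which both operators that
  have to be inverted are invertible. On the larger set \<open>N1\<close> the Newton step is defined.
\<close>

definition N :: "'a set"
  where "N = {x \<in> S. bij (blinfun_apply (A x)) \<and> bij (blinfun_apply (K x))}"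

definition N1 :: "'a set" where "N1 = {x \<in> S. bij (blinfun_apply (A x))}"

lemma N_subset: "N \<subseteq> N1" "N1 \<subseteq> S" by (auto simp: N_def N1_def)

lemma Ck_A: "Ck_on (Suc k) S F \<Longrightarrow> Ck_on k S A"
  by (rule Ck_on_Suc_iff_frechet[OF open_S, THEN iffD1, THEN conjunct2])

lemma Ck_B: "Ck_on (Suc (Suc k)) S F \<Longrightarrow> Ck_on k S B"
  by (rule Ck_on_Suc_iff_frechet[OF open_S, THEN iffD1, THEN conjunct2, OF Ck_A])

lemma open_preimage_bij:
  fixes g :: "'a \<Rightarrow> 'a \<Rightarrow>\<^sub>L 'a"
  assumes "open T" "continuous_on T g"
  shows "open {x \<in> T. bij (blinfun_apply (g x))}"
  using continuous_open_preimage[OF assms(2,1) open_bij_blinfun]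
  by (simp add: vimage_def Collect_conj_eq)

lemma open_N1: "open N1"
  unfolding N1_def
  using Ck_A[of 0] Ck_on_le[OF _ C4, of "Suc 0"] by (intro open_preimage_bij open_S) simp

lemma newton_eq: "x \<in> N1 \<Longrightarrow> n x = - blinfun_inv (A x) (F x)"
  by (simp add: newton_step_def N1_def blinfun_inv_apply)

lemma A_newton: "x \<in> N1 \<Longrightarrow> A x (n x) = - F x"
  by (simp add: newton_eq blinfun.minus_right) (simp add: N1_def)

lemma Ck_inv_A: "Ck_on (Suc k) S F \<Longrightarrow> Ck_on k N1 (\<lambda>x. blinfun_inv (A x))"
  by (rule Ck_on_blinfun_inv[OF open_N1 _ Ck_on_subset[OF Ck_A N_subset(2)]])
    (simp_all add: N1_def)

lemma Ck_newton:
  assumes "Ck_on (Suc k) S F" shows "Ck_on k N1 n"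
proof (rule Ck_on_cong[OF open_N1 newton_eq[symmetric]])
  show "Ck_on k N1 (\<lambda>x. - blinfun_inv (A x) (F x))"
    by (intro Ck_on_minus open_N1 Ck_on_bilinear[OF _ bounded_bilinear_blinfun_apply] Ck_inv_A assms
        Ck_on_subset[OF Ck_on_pred[OF assms]] N_subset)
qed

lemma Ck_K:
  assumes "Ck_on (Suc (Suc k)) S F" shows "Ck_on k N1 K"
  unfolding K_def[abs_def]
  by (intro Ck_on_add Ck_on_const Ck_on_scaleR Ck_on_bilinear[OF _ bounded_bilinear_blinfun_compose]
      Ck_on_bilinear[OF _ bounded_bilinear_blinfun_apply] open_N1 Ck_inv_A Ck_newton
      Ck_on_pred[OF assms] Ck_on_subset[OF Ck_B[OF assms]] N_subset)

lemma open_N: "open N"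
proof -
  have "continuous_on N1 K" using Ck_K[of 0] Ck_on_le[OF _ C4, of "Suc (Suc 0)"] by simp
  from open_preimage_bij[OF open_N1 this] show ?thesis by (simp add: N1_def N_def conj_assoc)
qed

lemma bij_A_Xs: "bij (blinfun_apply (A Xs))" and F_Xs [simp]: "F Xs = 0"
  using zero by (simp_all add: simple_zero_def)

lemma Xs_in_N1: "Xs \<in> N1" using Xs_in_S bij_A_Xs by (simp add: N1_def)

lemma newton_Xs [simp]: "n Xs = 0"
  using newton_eq[OF Xs_in_N1] by simp

lemma Xs_in_N: "Xs \<in> N"
proof -
  have "K Xs = id_blinfun" by (simp add: K_def)
  then have "bij (blinfun_apply (K Xs))"
    using bij_id by (simp add: id_def)
  then show ?thesis using Xs_in_S bij_A_Xs by (simp add: N_def)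
qed

lemma halley_op_eq: "x \<in> N1 \<Longrightarrow> halley_op F x = blinfun_apply (K x)"
  by (rule ext) (simp add: halley_op_def halley_L_def K_def N1_def blinfun_inv_apply
      blinfun.add_left blinfun.scaleR_left)

lemma halley_eq:
  assumes "x \<in> N" shows "h x = x + blinfun_inv (K x) (n x)"
  using assms halley_op_eq[of x] N_subset by (simp add: halley_def N_def N1_def blinfun_inv_apply)

lemma halley_defined_on_N:
  assumes "x \<in> N" shows "halley_defined F x"
proof -
  have S: "x \<in> S" using assms by (simp add: N_def)
  have "\<forall>\<^sub>F y in nhds x. y \<in> S" using open_S S by (rule eventually_nhds_in_open)
  then have "\<forall>\<^sub>F y in nhds x. F differentiable (at y)"
    by (rule eventually_mono) (use C4 in \<open>simp add: numeral_eq_Suc\<close>)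
  moreover have "frechet F differentiable (at x)"
    by (rule frechet2_apply(1)[OF open_S S Ck_on_le[OF _ C4]]) simp
  moreover have "bij (halley_op F x)"
    using halley_op_eq[of x] assms N_subset by (auto simp: N_def)
  ultimately show ?thesis using assms by (simp add: halley_defined_def N_def)
qed

lemma Ck_inv_K:
  assumes "Ck_on (Suc (Suc k)) S F" shows "Ck_on k N (\<lambda>x. blinfun_inv (K x))"
  by (rule Ck_on_blinfun_inv[OF open_N _ Ck_on_subset[OF Ck_K[OF assms] N_subset(1)]])
    (simp add: N_def)

lemma Ck_halley:
  assumes "Ck_on (Suc (Suc k)) S F" shows "Ck_on k N h"
proof (rule Ck_on_cong[OF open_N halley_eq[symmetric]])
  show "Ck_on k N (\<lambda>x. x + blinfun_inv (K x) (n x))"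
    by (intro Ck_on_add Ck_on_ident Ck_on_bilinear[OF _ bounded_bilinear_blinfun_apply] open_N
        Ck_inv_K assms Ck_on_subset[OF Ck_newton[OF Ck_on_pred[OF assms]]] N_subset)
qed

text \<open>The Halley step $\mathcal{H}(x) - x$ on \<open>N\<close>.\<close>

definition z :: "'a \<Rightarrow> 'a" where "z x = blinfun_inv (K x) (n x)"

text \<open>
  The operator $A(x)(I + \frac12 L(x)) = A(x) + \frac12 B(x)[H(x), \cdot]$. The step solves \<open>P x (z x) = - F x\<close>,
  an equation without inverses that can be differentiated repeatedly.
\<close>

definition P :: "'a \<Rightarrow> 'a \<Rightarrow>\<^sub>L 'a" where "P x = A x + (1/2) *\<^sub>R B x (n x)"

lemma P_z: assumes "x \<in> N" shows "P x (z x) = - F x"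
proof -
  have "P x v = A x (K x v)" for v
    using assms by (simp add: P_def K_def N_def blinfun.add_left blinfun.add_right
        blinfun.scaleR_left blinfun.scaleR_right)
  then show ?thesis using assms A_newton[of x] N_subset by (auto simp: z_def N_def)
qed

lemma Ck_N: "k \<le> 4 \<Longrightarrow> Ck_on k N F" "k \<le> 3 \<Longrightarrow> Ck_on k N A" "k \<le> 2 \<Longrightarrow> Ck_on k N B"
  "k \<le> 3 \<Longrightarrow> Ck_on k N n" "k \<le> 2 \<Longrightarrow> Ck_on k N (\<lambda>x. blinfun_inv (K x))"
proof -
  have NS: "N \<subseteq> S" using N_subset by blast
  have "Ck_on (Suc 3) S F" "Ck_on (Suc (Suc 2)) S F" using C4 by (simp_all del: Ck_on.simps)
  note Ck_A[OF this(1)] Ck_B[OF this(2)] Ck_newton[OF this(1)] Ck_inv_K[OF this(2)]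
  note this[THEN Ck_on_le[rotated]]
  from Ck_on_subset[OF Ck_on_le[OF _ C4] NS] Ck_on_subset[OF this(1) NS]
    Ck_on_subset[OF this(2) NS] Ck_on_subset[OF this(3) N_subset(1)] this(4)
  show "k \<le> 4 \<Longrightarrow> Ck_on k N F" "k \<le> 3 \<Longrightarrow> Ck_on k N A" "k \<le> 2 \<Longrightarrow> Ck_on k N B"
    "k \<le> 3 \<Longrightarrow> Ck_on k N n" "k \<le> 2 \<Longrightarrow> Ck_on k N (\<lambda>x. blinfun_inv (K x))"
    by simp_all
qed

lemma Ck_z: "Ck_on 2 N z"
  unfolding z_def[abs_def]
  by (intro Ck_on_bilinear[OF _ bounded_bilinear_blinfun_apply] open_N Ck_N) simp_all

lemma Ck_P: "Ck_on 2 N P"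
  unfolding P_def[abs_def]
  by (intro Ck_on_add Ck_on_scaleR Ck_on_bilinear[OF _ bounded_bilinear_blinfun_apply] open_N Ck_N)
    simp_all

lemma z_Xs [simp]: "z Xs = 0" by (simp add: z_def)

text \<open>
  The third derivative of the step exists at \<open>Xs\<close> although the step is only $C^2$ in general, because
  the Newton step is $C^3$ and vanishes there.
\<close>

lemma dir_deriv2_z_differentiable: "dir_deriv u (dir_deriv v z) differentiable (at Xs)"
proof -
  have "dir_deriv u (dir_deriv v n) differentiable (at Xs)"
    using Ck_N(4)[of 3] Xs_in_N by (simp add: numeral_3_eq_3)
  from has_derivative_dir_deriv2_bilinear_vanishing[OF bounded_bilinear_blinfun_apply open_N Xs_in_N
      Ck_N(5) Ck_N(4) newton_Xs this]
  show ?thesis unfolding z_def[abs_def] differentiable_def by auto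
qed

lemma dir_deriv_halley:
  assumes "x \<in> N"
  shows "dir_deriv v h x = v + dir_deriv v z x"
proof -
  have z: "z differentiable (at x)" using Ck_z assms by (simp add: numeral_2_eq_2)
  have "dir_deriv v h x = dir_deriv v (\<lambda>x. x + z x) x"
    by (rule dir_deriv_cong[OF open_N _ assms, symmetric])
      (simp_all add: halley_eq z_def[symmetric] z differentiable_add)
  then show ?thesis by (simp add: dir_deriv_add z)
qed

lemma dir_deriv2_halley:
  assumes "x \<in> N"
  shows "dir_deriv u (dir_deriv v h) x = dir_deriv u (dir_deriv v z) x"
proof -
  have z: "dir_deriv v z differentiable (at x)" using Ck_z assms by (simp add: numeral_2_eq_2)
  have "dir_deriv u (dir_deriv v h) x = dir_deriv u (\<lambda>x. v + dir_deriv v z x) x"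
    by (rule dir_deriv_cong[OF open_N _ assms, symmetric])
      (simp_all add: dir_deriv_halley z differentiable_add)
  then show ?thesis by (simp add: dir_deriv_add z)
qed

lemma frechet2_halley_differentiable: "frechet (frechet h) differentiable (at Xs)"
proof (rule differentiable_frechet2I[OF open_N Xs_in_N])
  show "Ck_on 2 N h" using Ck_halley[of 2] C4 by (simp add: numeral_eq_Suc)
  show "dir_deriv u (dir_deriv v h) differentiable (at Xs)" for u v
    by (rule differentiable_cong_open[OF open_N _ Xs_in_N dir_deriv2_z_differentiable])
      (simp add: dir_deriv2_halley)
qed

lemma dir_deriv_uminus_F:
  "dir_deriv u (\<lambda>x. - F x) Xs = - dir_deriv u F Xs"
  "dir_deriv u (dir_deriv u (\<lambda>x. - F x)) Xs = - dir_deriv u (dir_deriv u F) Xs"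
  "dir_deriv u (dir_deriv u (dir_deriv u (\<lambda>x. - F x))) Xs
    = - dir_deriv u (dir_deriv u (dir_deriv u F)) Xs"
proof -
  have d: "F differentiable (at x)" "dir_deriv u F differentiable (at x)"
    "dir_deriv u (dir_deriv u F) differentiable (at x)" if "x \<in> S" for x
    using C4 that by (simp_all add: numeral_eq_Suc)
  have neg: "dir_deriv u (\<lambda>x. - f x) x = - dir_deriv u f x" if "f differentiable (at x)"
    for f :: "'a \<Rightarrow> 'a" and x
    using that by (intro dir_deriv_bounded_linear) (auto intro: bounded_linear_minus bounded_linear_ident)
  have 1: "dir_deriv u (\<lambda>x. - F x) x = - dir_deriv u F x" if "x \<in> S" for x
    using d that by (intro neg)
  have 2: "dir_deriv u (dir_deriv u (\<lambda>x. - F x)) x = - dir_deriv u (dir_deriv u F) x" if "x \<in> S" for x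
    using dir_deriv_cong[OF open_S 1[symmetric] that, where v = u] neg[OF d(2)[OF that]] d(2)[OF that]
    by simp
  have 3: "dir_deriv u (dir_deriv u (dir_deriv u (\<lambda>x. - F x))) x
      = - dir_deriv u (dir_deriv u (dir_deriv u F)) x" if "x \<in> S" for x
    using dir_deriv_cong[OF open_S 2[symmetric] that, where v = u] neg[OF d(3)[OF that]] d(3)[OF that]
    by simp
  show "dir_deriv u (\<lambda>x. - F x) Xs = - dir_deriv u F Xs"
    "dir_deriv u (dir_deriv u (\<lambda>x. - F x)) Xs = - dir_deriv u (dir_deriv u F) Xs"
    "dir_deriv u (dir_deriv u (dir_deriv u (\<lambda>x. - F x))) Xs
      = - dir_deriv u (dir_deriv u (dir_deriv u F)) Xs"
    using 1 2 3 Xs_in_S by blast+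
qed

lemma dir_deriv_at_zero:
  shows "dir_deriv u F Xs = A Xs u"
    and "dir_deriv u (dir_deriv u F) Xs = B Xs u u"
    and "dir_deriv u (dir_deriv u (dir_deriv u F)) Xs = C Xs u u u"
    and "dir_deriv u A Xs = B Xs u"
    and "dir_deriv u (dir_deriv u A) Xs = C Xs u u"
    and "dir_deriv u B Xs = C Xs u"
    and "B Xs u v = B Xs v u"
proof -
  have F2: "Ck_on 2 S F" by (rule Ck_on_le[OF _ C4]) simp
  have "Ck_on (Suc (Suc 2)) S F" using C4 by (simp del: Ck_on.simps)
  then have A2: "Ck_on 2 S A" and B2: "Ck_on 2 S B"
    by (blast intro: Ck_A Ck_on_pred Ck_B)+
  have dF: "F differentiable (at Xs)" using C4 Xs_in_S by (simp add: numeral_eq_Suc)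
  have dB: "B differentiable (at Xs)" using B2 Xs_in_S by (simp add: numeral_eq_Suc)
  note fr2 = frechet2_apply[OF open_S Xs_in_S]
  show "dir_deriv u F Xs = A Xs u" by (rule frechet_apply[OF dF, symmetric])
  show "dir_deriv u (dir_deriv u F) Xs = B Xs u u" by (rule fr2(2)[OF F2, symmetric])
  show "dir_deriv u (dir_deriv u (dir_deriv u F)) Xs = C Xs u u u"
    by (rule frechet3_apply[OF open_S Xs_in_S F2 dB, symmetric])
  show "dir_deriv u A Xs = B Xs u" by (rule frechet_apply[OF fr2(1)[OF F2], symmetric])
  show "dir_deriv u (dir_deriv u A) Xs = C Xs u u" by (rule fr2(2)[OF A2, symmetric])
  show "dir_deriv u B Xs = C Xs u" by (rule frechet_apply[OF dB, symmetric])
  show "B Xs u v = B Xs v u"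
    by (simp add: fr2(2)[OF F2] dir_deriv_commute[OF open_S Xs_in_S F2, of u v])
qed

lemma inv_A: "blinfun_inv (A Xs) (A Xs x) = x" "A Xs (blinfun_inv (A Xs) x) = x"
  using bij_A_Xs by simp_all

lemma A_Xs_cancel: "A Xs v = A Xs w \<Longrightarrow> v = w"
  using bij_A_Xs by (simp add: bij_is_inj inj_eq)

text \<open>
  The derivatives at \<open>Xs\<close> of a solution \<open>y\<close> of the equation \<open>Q x (y x) = - F x\<close> on \<open>N\<close>, obtained by
  differentiating the equation up to three times. It applies to the Newton step with \<open>Q = A\<close>, and to
  the Halley step with \<open>Q = P\<close>.
\<close>

lemma equation_derivatives:
  fixes Q :: "'a \<Rightarrow> 'a \<Rightarrow>\<^sub>L 'a"
  assumes Q: "Ck_on 2 N Q" and y: "Ck_on 2 N y" and eq: "\<And>x. x \<in> N \<Longrightarrow> Q x (y x) = - F x"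
    and [simp]: "y Xs = 0" "Q Xs = A Xs"
  shows "dir_deriv u y Xs = - u"
    and "A Xs (dir_deriv u (dir_deriv u y) Xs) = 2 *\<^sub>R dir_deriv u Q Xs u - B Xs u u"
    and "dir_deriv u (dir_deriv u y) differentiable (at Xs) \<Longrightarrow>
      A Xs (dir_deriv u (dir_deriv u (dir_deriv u y)) Xs)
        = 3 *\<^sub>R dir_deriv u (dir_deriv u Q) Xs u
          - 3 *\<^sub>R dir_deriv u Q Xs (dir_deriv u (dir_deriv u y) Xs) - C Xs u u u"
proof -
  have Qd: "Q differentiable (at x)" and yd: "y differentiable (at x)" if "x \<in> N" for x
    using Q y that by (simp_all add: numeral_2_eq_2)
  let ?Qy = "\<lambda>x. Q x (y x)"
  have Ck_Qy: "Ck_on 2 N ?Qy"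
    by (rule Ck_on_bilinear[OF open_N bounded_bilinear_blinfun_apply Q y])
  have eq1: "dir_deriv u ?Qy x = dir_deriv u (\<lambda>x. - F x) x" if "x \<in> N" for x
    using Ck_Qy that by (intro dir_deriv_cong[OF open_N eq that]) (auto simp: numeral_2_eq_2)
  have eq2: "dir_deriv u (dir_deriv u ?Qy) x = dir_deriv u (dir_deriv u (\<lambda>x. - F x)) x"
    if "x \<in> N" for x
    using Ck_Qy that by (intro dir_deriv_cong[OF open_N eq1 that]) (auto simp: numeral_2_eq_2)
  have "dir_deriv u ?Qy Xs = A Xs (dir_deriv u y Xs)"
    by (simp add: dir_deriv_bilinear[OF bounded_bilinear_blinfun_apply Qd yd] Xs_in_N
        blinfun.zero_right)
  then have "A Xs (dir_deriv u y Xs) = A Xs (- u)"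
    by (simp add: eq1[OF Xs_in_N] dir_deriv_uminus_F dir_deriv_at_zero blinfun.minus_right)
  then show y1: "dir_deriv u y Xs = - u" by (rule A_Xs_cancel)
  have "dir_deriv u (dir_deriv u ?Qy) Xs
    = A Xs (dir_deriv u (dir_deriv u y) Xs) - 2 *\<^sub>R dir_deriv u Q Xs u"
    by (simp add: dir_deriv2_bilinear[OF bounded_bilinear_blinfun_apply open_N Xs_in_N Q y] y1
        blinfun.minus_right blinfun.zero_right scaleR_2)
  then show "A Xs (dir_deriv u (dir_deriv u y) Xs) = 2 *\<^sub>R dir_deriv u Q Xs u - B Xs u u"
    by (simp add: eq2[OF Xs_in_N] dir_deriv_uminus_F dir_deriv_at_zero algebra_simps)
  assume y3: "dir_deriv u (dir_deriv u y) differentiable (at Xs)"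
  note D = has_derivative_dir_deriv2_bilinear_vanishing[OF bounded_bilinear_blinfun_apply open_N
      Xs_in_N Q y \<open>y Xs = 0\<close> y3]
  have "dir_deriv u (dir_deriv u (dir_deriv u ?Qy)) Xs = A Xs (dir_deriv u (dir_deriv u (dir_deriv u y)) Xs)
    + 3 *\<^sub>R dir_deriv u Q Xs (dir_deriv u (dir_deriv u y) Xs)
    - 3 *\<^sub>R dir_deriv u (dir_deriv u Q) Xs u"
    unfolding dir_deriv_eq[OF D] y1 by (simp add: blinfun.minus_right algebra_simps scaleR_3)
  moreover have "dir_deriv u (dir_deriv u (dir_deriv u ?Qy)) Xs
    = dir_deriv u (dir_deriv u (dir_deriv u (\<lambda>x. - F x))) Xs"
    using D unfolding differentiable_def by (intro dir_deriv_cong[OF open_N eq2 Xs_in_N]) (auto simp: differentiable_def)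
  ultimately show "A Xs (dir_deriv u (dir_deriv u (dir_deriv u y)) Xs)
        = 3 *\<^sub>R dir_deriv u (dir_deriv u Q) Xs u
          - 3 *\<^sub>R dir_deriv u Q Xs (dir_deriv u (dir_deriv u y) Xs) - C Xs u u u"
    by (simp add: dir_deriv_uminus_F dir_deriv_at_zero algebra_simps)
qed

lemma newton_derivatives:
  "dir_deriv u n Xs = - u"
  "dir_deriv u (dir_deriv u n) Xs = blinfun_inv (A Xs) (B Xs u u)"
proof -
  have eq: "A x (n x) = - F x" if "x \<in> N" for x using A_newton that N_subset by blast
  have "Ck_on 2 N A" "Ck_on 2 N n" by (simp_all add: Ck_N del: Ck_on.simps)
  note E = equation_derivatives[OF this eq newton_Xs refl, of u]
  show "dir_deriv u n Xs = - u" using E(1) by simp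
  have "A Xs (dir_deriv u (dir_deriv u n) Xs) = B Xs u u"
    using E(2) by (simp add: dir_deriv_at_zero scaleR_2)
  then show "dir_deriv u (dir_deriv u n) Xs = blinfun_inv (A Xs) (B Xs u u)"
    using inv_A(1) by metis
qed

lemma P_derivatives:
  "P Xs = A Xs"
  "dir_deriv u P Xs = (1/2) *\<^sub>R B Xs u"
  "dir_deriv u (dir_deriv u P) Xs = (1/2) *\<^sub>R B Xs (blinfun_inv (A Xs) (B Xs u u))"
proof -
  have A2: "Ck_on 2 N A" and B2: "Ck_on 2 N B" and n2: "Ck_on 2 N n"
    by (simp_all add: Ck_N del: Ck_on.simps)
  let ?Bn = "\<lambda>x. B x (n x)" let ?Bn2 = "\<lambda>x. (1/2) *\<^sub>R B x (n x)"
  have Bn: "Ck_on 2 N ?Bn"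
    by (rule Ck_on_bilinear[OF open_N bounded_bilinear_blinfun_apply B2 n2])
  have d: "f differentiable (at x)" "dir_deriv u f differentiable (at x)" if "Ck_on 2 N f" "x \<in> N"
    for f :: "'a \<Rightarrow> 'b::real_normed_vector" and x
    using that by (simp_all add: numeral_2_eq_2)
  show "P Xs = A Xs" by (simp add: P_def blinfun.zero_right)
  note sc = dir_deriv_bounded_linear[OF bounded_linear_scaleR_right]
    differentiable_bounded_linear[OF bounded_linear_scaleR_right]
  have P1: "dir_deriv u P x = dir_deriv u A x + (1/2) *\<^sub>R dir_deriv u ?Bn x" if "x \<in> N" for x
    unfolding P_def[abs_def] using that
    by (simp add: dir_deriv_add sc d[OF A2] d[OF Bn])
  have "dir_deriv u (dir_deriv u P) Xs
    = dir_deriv u (\<lambda>x. dir_deriv u A x + (1/2) *\<^sub>R dir_deriv u ?Bn x) Xs"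
    by (rule dir_deriv_cong[OF open_N _ Xs_in_N], erule P1) (rule d[OF Ck_P Xs_in_N])
  also have "\<dots> = dir_deriv u (dir_deriv u A) Xs + (1/2) *\<^sub>R dir_deriv u (dir_deriv u ?Bn) Xs"
    using Xs_in_N by (simp add: dir_deriv_add sc d[OF A2] d[OF Bn])
  also have "dir_deriv u (dir_deriv u ?Bn) Xs
    = B Xs (blinfun_inv (A Xs) (B Xs u u)) - 2 *\<^sub>R C Xs u u"
    by (simp add: dir_deriv2_bilinear[OF bounded_bilinear_blinfun_apply open_N Xs_in_N B2 n2]
        newton_derivatives dir_deriv_at_zero blinfun.minus_right blinfun.zero_right scaleR_2)
  finally show "dir_deriv u (dir_deriv u P) Xs = (1/2) *\<^sub>R B Xs (blinfun_inv (A Xs) (B Xs u u))"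
    by (simp add: dir_deriv_at_zero scaleR_diff_right)
  have "dir_deriv u ?Bn Xs = - B Xs u"
    by (simp add: dir_deriv_bilinear[OF bounded_bilinear_blinfun_apply d(1)[OF B2 Xs_in_N]
          d(1)[OF n2 Xs_in_N]] newton_derivatives blinfun.minus_right blinfun.zero_right)
  then show "dir_deriv u P Xs = (1/2) *\<^sub>R B Xs u"
    using P1[OF Xs_in_N] scaleR_diff_left[of 1 "1/2" "B Xs u"] by (simp add: dir_deriv_at_zero)
qed

lemma matrix_schwarzian_eq:
  "matrix_schwarzian F Xs u = 2 *\<^sub>R blinfun_inv (A Xs) (C Xs u u u)
    - 3 *\<^sub>R blinfun_inv (A Xs) (B Xs u (blinfun_inv (A Xs) (B Xs u u)))"
  by (simp add: matrix_schwarzian_def Let_def blinfun_inv_apply[OF bij_A_Xs])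

text \<open>
  In the equation for the Halley step the first derivative of \<open>P\<close> is half of that of \<open>A\<close>, so that the
  second-order terms cancel. At third order only the second derivative of \<open>P\<close> and $D^3 F$ remain, and
  together they form the Schwarzian.
\<close>

lemma z_derivatives:
  "dir_deriv u z Xs = - u"
  "dir_deriv u (dir_deriv u z) Xs = 0"
  "dir_deriv u (dir_deriv u (dir_deriv u z)) Xs = - (1/2) *\<^sub>R matrix_schwarzian F Xs u"
proof -
  note E = equation_derivatives[OF Ck_P Ck_z P_z z_Xs P_derivatives(1), of u]
  let ?w = "blinfun_inv (A Xs) (B Xs u u)"
  show "dir_deriv u z Xs = - u" using E(1) by simp
  have "A Xs (dir_deriv u (dir_deriv u z) Xs) = 0"
    using E(2) by (simp add: P_derivatives blinfun.scaleR_left)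
  then show z2: "dir_deriv u (dir_deriv u z) Xs = 0"
    using A_Xs_cancel blinfun.zero_right by metis
  have "A Xs (dir_deriv u (dir_deriv u (dir_deriv u z)) Xs) = (3/2) *\<^sub>R B Xs u ?w - C Xs u u u"
    using E(3)[OF _ dir_deriv2_z_differentiable]
    by (simp add: P_derivatives blinfun.scaleR_left z2 blinfun.zero_right dir_deriv_at_zero(7)[of u ?w])
  then have "dir_deriv u (dir_deriv u (dir_deriv u z)) Xs
      = blinfun_inv (A Xs) ((3/2) *\<^sub>R B Xs u ?w - C Xs u u u)"
    using inv_A(1) by metis
  then show "dir_deriv u (dir_deriv u (dir_deriv u z)) Xs = - (1/2) *\<^sub>R matrix_schwarzian F Xs u"
    by (simp add: matrix_schwarzian_eq blinfun.diff_right blinfun.scaleR_right scaleR_diff_right)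
qed

lemma Ck2_halley: "Ck_on 2 N h"
  using Ck_halley[of 2] C4 by (simp add: numeral_eq_Suc)

lemma frechet_halley: "frechet h Xs u = 0"
proof -
  have "h differentiable (at Xs)" using Ck2_halley Xs_in_N by (simp add: numeral_2_eq_2)
  then show ?thesis by (simp add: frechet_apply dir_deriv_halley Xs_in_N z_derivatives)
qed

lemma frechet2_halley: "frechet (frechet h) Xs u u = 0"
  by (simp add: frechet2_apply[OF open_N Xs_in_N Ck2_halley] dir_deriv2_halley Xs_in_N z_derivatives)

lemma frechet3_halley:
  "frechet (frechet (frechet h)) Xs u u u = - (1/2) *\<^sub>R matrix_schwarzian F Xs u"
proof -
  have "frechet (frechet (frechet h)) Xs u u u = dir_deriv u (dir_deriv u (dir_deriv u h)) Xs"
    by (rule frechet3_apply[OF open_N Xs_in_N Ck2_halley frechet2_halley_differentiable])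
  also have "\<dots> = dir_deriv u (dir_deriv u (dir_deriv u z)) Xs"
    by (rule dir_deriv_cong[OF open_N _ Xs_in_N dir_deriv2_z_differentiable, symmetric])
      (simp add: dir_deriv2_halley)
  finally show ?thesis by (simp add: z_derivatives)
qed

section \<open>Local convergence of the iteration\<close>

text \<open>
  The Schwarzian at \<open>Xs\<close> is a multiple of the diagonal of the bounded trilinear map
  $D^3 \mathcal{H}(X^\ast)$; its homogeneity, continuity and bound follow from this.
\<close>

abbreviation Sch where "Sch \<equiv> matrix_schwarzian F Xs"

lemma Sch_eq: "Sch u = - 2 *\<^sub>R frechet (frechet (frechet h)) Xs u u u"
  by (simp add: frechet3_halley)

lemma Sch_scaleR: "Sch (c *\<^sub>R u) = c ^ 3 *\<^sub>R Sch u"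
  by (simp add: Sch_eq blinfun.scaleR_right blinfun.scaleR_left power3_eq_cube mult.assoc del: scaleR_minus_left)

lemma tendsto_Sch: "(f \<longlongrightarrow> u) G \<Longrightarrow> ((\<lambda>k. Sch (f k)) \<longlongrightarrow> Sch u) G"
  unfolding Sch_eq by (intro tendsto_intros)

lemma norm_Sch_le: "\<exists>M>0. \<forall>u. norm (Sch u) \<le> M * norm u ^ 3"
proof (intro exI conjI allI)
  let ?D = "frechet (frechet (frechet h)) Xs"
  show "0 < 2 * norm ?D + 1" by (simp add: add_nonneg_pos)
  fix u
  have "norm (?D u u u) \<le> norm (?D u u) * norm u" by (rule norm_blinfun)
  also have "\<dots> \<le> (norm (?D u) * norm u) * norm u"
    by (intro mult_right_mono norm_blinfun) simp
  also have "\<dots> \<le> ((norm ?D * norm u) * norm u) * norm u"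
    by (intro mult_right_mono norm_blinfun) simp_all
  finally have "norm (Sch u) \<le> 2 * norm ?D * norm u ^ 3"
    by (simp add: Sch_eq power3_eq_cube mult.assoc)
  also have "\<dots> \<le> (2 * norm ?D + 1) * norm u ^ 3" by (intro mult_right_mono) auto
  finally show "norm (Sch u) \<le> (2 * norm ?D + 1) * norm u ^ 3" .
qed

lemma halley_Xs [simp]: "h Xs = Xs" by (simp add: halley_eq[OF Xs_in_N])

lemma halley_expansion:
  assumes "e > 0"
  shows "\<exists>d>0. \<forall>x. norm (x - Xs) < d \<longrightarrow>
    norm (h x - Xs - (- (1/12)) *\<^sub>R Sch (x - Xs)) \<le> e * norm (x - Xs) ^ 3"
proof -
  obtain d where d: "d > 0" "\<And>k. norm k < d \<Longrightarrow>
    norm (h (Xs + k) - h Xs - frechet h Xs k - (1/2) *\<^sub>R frechet (frechet h) Xs k k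
      - (1/6) *\<^sub>R frechet (frechet (frechet h)) Xs k k k) \<le> e * norm k ^ 3"
    using taylor_young_3[OF open_N Xs_in_N Ck2_halley frechet2_halley_differentiable assms] by blast
  show ?thesis
  proof (intro exI[of _ d] conjI allI impI d)
    fix x assume "norm (x - Xs) < d"
    from d(2)[OF this] show "norm (h x - Xs - (- (1/12)) *\<^sub>R Sch (x - Xs)) \<le> e * norm (x - Xs) ^ 3"
      by (simp add: frechet_halley frechet2_halley frechet3_halley)
  qed
qed

lemma halley_cubic_bound:
  "\<exists>d>0. \<exists>c>0. \<forall>x. norm (x - Xs) < d \<longrightarrow> x \<in> N \<and> norm (h x - Xs) \<le> c * norm (x - Xs) ^ 3"
proof -
  obtain d where d: "d > 0" "\<And>x. norm (x - Xs) < d \<Longrightarrow>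
    norm (h x - Xs - (- (1/12)) *\<^sub>R Sch (x - Xs)) \<le> 1 * norm (x - Xs) ^ 3"
    using halley_expansion[OF zero_less_one] by blast
  obtain d' where d': "d' > 0" "\<And>x. dist x Xs < d' \<Longrightarrow> x \<in> N"
    using open_N Xs_in_N unfolding open_dist by blast
  obtain M where M: "M > 0" "\<And>u. norm (Sch u) \<le> M * norm u ^ 3" using norm_Sch_le by blast
  have "norm (h x - Xs) \<le> (1 + M) * norm (x - Xs) ^ 3" if "norm (x - Xs) < d" for x
  proof -
    have "norm (h x - Xs) \<le> norm (h x - Xs - (- (1/12)) *\<^sub>R Sch (x - Xs))
      + norm ((- (1/12)) *\<^sub>R Sch (x - Xs))"
      by (subst add.commute) (rule norm_triangle_sub)
    then show ?thesis using d(2)[OF that] M(2)[of "x - Xs"] norm_ge_zero[of "Sch (x - Xs)"]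
      by (simp add: algebra_simps del: norm_ge_zero)
  qed
  then show ?thesis using d(1) d' M(1)
    by (intro exI[of _ "min d d'"] conjI exI[of _ "1 + M"]) (auto simp: dist_norm)
qed

lemma halley_local_convergence:
  "\<exists>r>0. \<exists>c>0. \<forall>X0. norm (X0 - Xs) < r \<longrightarrow>
    (let X = (\<lambda>k. (h ^^ k) X0) in
      halley_sequence F X \<and> (\<forall>k. X k \<in> N) \<and> X \<longlonglongrightarrow> Xs \<and>
      (\<forall>k. norm (X (Suc k) - Xs) \<le> c * norm (X k - Xs) ^ 3))"
proof -
  obtain d c where d: "d > 0" and c: "c > 0"
    and bound: "\<And>x. norm (x - Xs) < d \<Longrightarrow> x \<in> N \<and> norm (h x - Xs) \<le> c * norm (x - Xs) ^ 3"
    using halley_cubic_bound by blast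
  \<comment> \<open>Within this radius $c \|x - X^\ast\|^2 \le 1/2$, so that the map halves the distance to \<open>Xs\<close>.\<close>
  define r where "r = min d (min 1 (1 / (2 * c)))"
  have "r > 0" using d c by (simp add: r_def)
  have half: "norm (h x - Xs) \<le> norm (x - Xs) / 2" if "norm (x - Xs) < r" for x
  proof -
    have x: "norm (x - Xs) < d" "norm (x - Xs) \<le> 1" "c * norm (x - Xs) \<le> 1/2"
      using that c by (auto simp: r_def field_simps)
    have "c * norm (x - Xs) ^ 3 = (c * norm (x - Xs)) * norm (x - Xs) * norm (x - Xs)"
      by (simp add: power3_eq_cube)
    also have "\<dots> \<le> (1/2) * 1 * norm (x - Xs)"
      using x c by (intro mult_right_mono mult_mono) auto
    finally show ?thesis using bound[OF x(1)] by simp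
  qed
  have "let X = (\<lambda>k. (h ^^ k) X0) in halley_sequence F X \<and> (\<forall>k. X k \<in> N) \<and> X \<longlonglongrightarrow> Xs \<and>
      (\<forall>k. norm (X (Suc k) - Xs) \<le> c * norm (X k - Xs) ^ 3)" if X0: "norm (X0 - Xs) < r" for X0
  proof -
    define X where "X k = (h ^^ k) X0" for k
    have geo: "norm (X k - Xs) \<le> norm (X0 - Xs) * (1/2) ^ k" for k
    proof (induction k)
      case (Suc k)
      have "norm (X0 - Xs) * (1/2) ^ k \<le> norm (X0 - Xs) * 1"
        by (intro mult_left_mono power_le_one) auto
      then have "norm (X k - Xs) < r" using Suc X0 by linarith
      from half[OF this] Suc show ?case by (simp add: X_def)
    qed (simp add: X_def)
    have small: "norm (X k - Xs) < r" for k
    proof -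
      have "norm (X0 - Xs) * (1/2) ^ k \<le> norm (X0 - Xs) * 1"
        by (intro mult_left_mono power_le_one) auto
      then show ?thesis using geo[of k] X0 by linarith
    qed
    then have XN: "X k \<in> N" and "norm (X (Suc k) - Xs) \<le> c * norm (X k - Xs) ^ 3" for k
      using bound[of "X k"] by (auto simp: r_def X_def)
    moreover have "halley_sequence F X"
      using XN halley_defined_on_N by (auto simp: halley_sequence_def) (simp add: X_def)
    moreover have "X \<longlonglongrightarrow> Xs"
    proof (rule Lim_null[THEN iffD2], rule Lim_null_comparison)
      show "\<forall>\<^sub>F k in sequentially. norm (X k - Xs) \<le> norm (X0 - Xs) * (1/2) ^ k"
        using geo by simp
      show "(\<lambda>k. norm (X0 - Xs) * (1/2) ^ k) \<longlonglongrightarrow> 0"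
        by (intro tendsto_mult_right_zero LIMSEQ_power_zero) simp
    qed
    ultimately show ?thesis unfolding X_def[abs_def] Let_def by blast
  qed
  then show ?thesis using \<open>r > 0\<close> c by blast
qed

context
  fixes X :: "nat \<Rightarrow> 'a"
  assumes seq: "halley_sequence F X" and lim: "X \<longlonglongrightarrow> Xs"
begin

lemma halley_sequence_Suc: "X (Suc k) = h (X k)"
  using seq by (simp add: halley_sequence_def)

lemma eventually_close: "d > 0 \<Longrightarrow> \<forall>\<^sub>F k in sequentially. norm (X k - Xs) < d"
  using tendstoD[OF lim] by (simp add: dist_norm)

lemma halley_sequence_expansion:
  assumes "e > 0"
  shows "\<forall>\<^sub>F k in sequentially.
    norm (X (Suc k) - Xs - (- (1/12)) *\<^sub>R Sch (X k - Xs)) \<le> e * norm (X k - Xs) ^ 3"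
proof -
  obtain d where d: "d > 0" "\<And>x. norm (x - Xs) < d \<Longrightarrow>
    norm (h x - Xs - (- (1/12)) *\<^sub>R Sch (x - Xs)) \<le> e * norm (x - Xs) ^ 3"
    using halley_expansion[OF assms] by blast
  show ?thesis using eventually_close[OF d(1)] 
    by (rule eventually_mono) (use d(2) halley_sequence_Suc in simp)
qed

lemma halley_sequence_smallo:
  "(\<lambda>k. norm (X (Suc k) - Xs - (- (1/12)) *\<^sub>R Sch (X k - Xs))) \<in> o(\<lambda>k. norm (X k - Xs) ^ 3)"
  by (rule landau_o.smallI) (use halley_sequence_expansion in simp)

lemma halley_sequence_order_at_least: "order_at_least 3 X Xs"
proof -
  obtain d c where d: "d > 0" and c: "c > 0"
    and bound: "\<And>x. norm (x - Xs) < d \<Longrightarrow> norm (h x - Xs) \<le> c * norm (x - Xs) ^ 3"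
    using halley_cubic_bound by blast
  have "\<forall>\<^sub>F k in sequentially. norm (X (Suc k) - Xs) \<le> c * norm (X k - Xs) ^ 3"
    using eventually_close[OF d] by (rule eventually_mono) (use bound halley_sequence_Suc in simp)
  then show ?thesis unfolding order_at_least_def by (intro landau_o.bigI[of c] c) simp
qed

text \<open>
  Dividing the expansion by the cube of the error norm turns its main term into the Schwarzian at the
  normalized errors, which converges to the Schwarzian at the asymptotic direction.
\<close>

lemma halley_sequence_order_exactly:
  assumes dir: "asymptotic_direction X Xs U" and "Sch U \<noteq> 0"
  shows "order_exactly 3 X Xs"
proof -
  let ?u = "\<lambda>k. (X k - Xs) /\<^sub>R norm (X k - Xs)"
  let ?q = "\<lambda>k. (X (Suc k) - Xs) /\<^sub>R norm (X k - Xs) ^ 3"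
  have nz: "X k \<noteq> Xs" for k using dir by (simp add: asymptotic_direction_def)
  have u: "?u \<longlonglongrightarrow> U" using dir by (simp add: asymptotic_direction_def)
  have norm_div: "norm (v /\<^sub>R r) = norm v / r" if "r > 0" for v :: 'a and r
    using that by (simp add: divide_inverse mult.commute)
  have "(\<lambda>k. ?q k - (- (1/12)) *\<^sub>R Sch (?u k)) \<longlonglongrightarrow> 0"
  proof (rule tendstoI)
    fix e :: real assume "e > 0"
    then have "\<forall>\<^sub>F k in sequentially.
        norm (X (Suc k) - Xs - (- (1/12)) *\<^sub>R Sch (X k - Xs)) \<le> (e/2) * norm (X k - Xs) ^ 3"
      by (intro halley_sequence_expansion) simp
    then show "\<forall>\<^sub>F k in sequentially. dist (?q k - (- (1/12)) *\<^sub>R Sch (?u k)) 0 < e"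
    proof (rule eventually_mono)
      fix k
      assume le: "norm (X (Suc k) - Xs - (- (1/12)) *\<^sub>R Sch (X k - Xs)) \<le> (e/2) * norm (X k - Xs) ^ 3"
      have pos: "norm (X k - Xs) ^ 3 > 0" using nz by simp
      have eq: "?q k - (- (1/12)) *\<^sub>R Sch (?u k)
        = (X (Suc k) - Xs - (- (1/12)) *\<^sub>R Sch (X k - Xs)) /\<^sub>R norm (X k - Xs) ^ 3"
        unfolding Sch_scaleR power_inverse by (simp add: scaleR_diff_right scaleR_add_right)
      have "norm (?q k - (- (1/12)) *\<^sub>R Sch (?u k))
        = norm (X (Suc k) - Xs - (- (1/12)) *\<^sub>R Sch (X k - Xs)) / norm (X k - Xs) ^ 3"
        unfolding eq by (rule norm_div[OF pos])
      also have "\<dots> \<le> e/2" using le pos by (simp add: divide_le_eq)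
      finally show "dist (?q k - (- (1/12)) *\<^sub>R Sch (?u k)) 0 < e" using \<open>e > 0\<close> by simp
    qed
  qed
  from tendsto_add[OF this bounded_linear.tendsto[OF bounded_linear_scaleR_right[of "- (1/12)"]
        tendsto_Sch[OF u]]]
  have "?q \<longlonglongrightarrow> (- (1/12)) *\<^sub>R Sch U" by simp
  moreover have "norm (?q k) = norm (X (Suc k) - Xs) / norm (X k - Xs) ^ 3" for k
    by (rule norm_div) (simp add: nz)
  ultimately have "(\<lambda>k. norm (X (Suc k) - Xs) / norm (X k - Xs) ^ 3) \<longlonglongrightarrow> norm (Sch U) / 12"
    using tendsto_norm[of ?q "(- (1/12)) *\<^sub>R Sch U" sequentially] by (simp only: norm_scaleR) simp
  then show ?thesis unfolding order_exactly_def using \<open>Sch U \<noteq> 0\<close>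
    by (intro exI[of _ "norm (Sch U) / 12"]) simp
qed

end

end

theorem theorem8:
  fixes F :: "real^'n^'m \<Rightarrow> real^'n^'m"
    and S :: "(real^'n^'m) set"
    and Xs :: "real^'n^'m"
  assumes "open S" and "Xs \<in> S"
    and "C4_on S F"
    and "simple_zero F Xs"
  shows
    "\<exists>N. open N \<and> Xs \<in> N \<and>
      \<comment> \<open>(1)\<close>
      (\<forall>X\<in>N. halley_defined F X) \<and>
      C2_on N (halley F) \<and>
      frechet (frechet (halley F)) differentiable (at Xs) \<and>
      (C5_on S F \<longrightarrow> C3_on N (halley F)) \<and>
      (\<forall>U. frechet (halley F) Xs U = 0 \<and>
           frechet (frechet (halley F)) Xs U U = 0 \<and>
           frechet (frechet (frechet (halley F))) Xs U U U
             = - (1/2) *\<^sub>R matrix_schwarzian F Xs U) \<and>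
      \<comment> \<open>(2)\<close>
      (\<exists>r>0. \<exists>C>0. \<forall>X0. norm (X0 - Xs) < r \<longrightarrow>
         (let X = (\<lambda>k. (halley F ^^ k) X0) in
            halley_sequence F X \<and> (\<forall>k. X k \<in> N) \<and> X \<longlonglongrightarrow> Xs \<and>
            (\<forall>k. norm (X (Suc k) - Xs) \<le> C * norm (X k - Xs) ^ 3))) \<and>
      \<comment> \<open>(3)\<close>
      (\<forall>X. halley_sequence F X \<and> X \<longlonglongrightarrow> Xs \<longrightarrow>
         (\<lambda>k. norm (X (Suc k) - Xs - (- (1/12)) *\<^sub>R matrix_schwarzian F Xs (X k - Xs)))
           \<in> o(\<lambda>k. norm (X k - Xs) ^ 3) \<and>
         order_at_least 3 X Xs \<and>
         (\<forall>U. asymptotic_direction X Xs U \<and> matrix_schwarzian F Xs U \<noteq> 0 \<longrightarrow>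
            order_exactly 3 X Xs))"
proof -
  interpret halley_zero F S Xs
    using assms by unfold_locales (simp_all add: C4_on_iff)
  have "C2_on N (halley F)" using Ck2_halley by (simp add: C2_on_iff[OF open_N])
  moreover have "C5_on S F \<longrightarrow> C3_on N (halley F)"
  proof
    assume "C5_on S F"
    then have "Ck_on (Suc (Suc 3)) S F" by (simp add: C5_on_iff[OF open_S] del: Ck_on.simps)
    from Ck_halley[OF this] show "C3_on N (halley F)" by (simp add: C3_on_iff[OF open_N])
  qed
  moreover have "\<forall>u. frechet h Xs u = 0 \<and> frechet (frechet h) Xs u u = 0 \<and>
      frechet (frechet (frechet h)) Xs u u u = - (1/2) *\<^sub>R matrix_schwarzian F Xs u"
    by (intro allI conjI frechet_halley frechet2_halley frechet3_halley)
  moreover have "\<forall>X. halley_sequence F X \<and> X \<longlonglongrightarrow> Xs \<longrightarrow>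
      (\<lambda>k. norm (X (Suc k) - Xs - (- (1/12)) *\<^sub>R matrix_schwarzian F Xs (X k - Xs)))
        \<in> o(\<lambda>k. norm (X k - Xs) ^ 3) \<and>
      order_at_least 3 X Xs \<and>
      (\<forall>U. asymptotic_direction X Xs U \<and> matrix_schwarzian F Xs U \<noteq> 0 \<longrightarrow> order_exactly 3 X Xs)"
    using halley_sequence_smallo halley_sequence_order_at_least halley_sequence_order_exactly
    by blast
  moreover have "\<forall>x\<in>N. halley_defined F x" using halley_defined_on_N by blast
  moreover note open_N Xs_in_N frechet2_halley_differentiable halley_local_convergence
  ultimately show ?thesis by (intro exI[of _ N] conjI)
qed

end
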